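(* Consider the problem and Algorithm CLVR described in the context, and let $\gamma>0$ be its parameter. Let $x_k,y_k$, $k\in[K]$, be the iterates of CLVR, and for $k\in[K]$ define $$\tilde x_k=\frac1{A_k}\sum_{i=1}^k a_i x_i,\qquad \tilde y_k=\frac1{A_k}\sum_{i=1}^k\big(a_i y_i+(m-1)a_i(y_i-y_{i-1})\big).$$ Let $\mathcal W_k\subset\mathcal X\times\mathbb R^n$, $k\in[K]$, be a sequence of compact convex sets such that $(\tilde x_k,\tilde y_k)\in\mathcal W_k\subset\mathcal W\subset\mathcal X\times\mathbb R^n$, where $\mathcal W$ is also convex and compact. Let $(x^*,y^* )$ be a primal-dual solution. Then for every $k\in[K]$: $$\mathbb E\Big[\sup_{(u,v)\in\mathcal W_k}\{\mathcal L(\tilde x_k,v)-\mathcal L(u,\tilde y_k)\}\Big]\le\frac1{A_k}\Big(\mathbb E\Big[\frac\gamma2\|\hat u-x_0\|^2+\frac1\gamma\|\hat v-y_0\|^2\Big]+\frac\gamma2\|x^*-x_0\|^2+\frac1{2\gamma}\|y^*-y_0\|^2\Big),$$ where $(\hat u,\hat v)=\arg\sup_{(u,v)\in\mathcal W_k}\{\mathcal L(\tilde x_k,v)-\mathcal L(u,\tilde y_k)\}$. Furthermore, $$\mathbb E\Big[\frac{\gamma+\sigma A_k}4\|x_k-x^*\|^2+\frac1{2\gamma}\|y_k-y^*\|^2\Big]\le\frac\gamma2\|x^*-x_0\|^2+\frac1{2\gamma}\|y^*-y_0\|^2.$$ Define $K_0=\big\lceil\frac{\sigma}{18\hat Lm\gamma}\big\rceil$.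 Then in the bounds above: $$A_k\ge\max\Big\{\frac{k}{2\hat Lm},\ \frac{\sigma}{(6\hat Lm)^2\gamma}\Big(k-K_0+\max\Big\{3\sqrt{2\hat Lm\gamma/\sigma},\,1\Big\}\Big)^2\Big\}.$$ Expectations are over all the randomness of the algorithm.
   Context: Setting. $\mathcal X\subseteq\mathbb R^d$ is closed and convex, $c\in\mathbb R^d$, $A\in\mathbb R^{n\times d}$, $b\in\mathbb R^n$, and $r:\mathbb R^d\to\mathbb R$ is convex. The problem is $\min_{x\in\mathcal X}\max_{y\in\mathbb R^n}\mathcal L(x,y)$ with $\mathcal L(x,y)=c^Tx+r(x)+y^TAx-y^Tb$. A primal-dual solution (Nash point) is $(x^*,y^* )\in\mathcal X\times\mathbb R^n$ with $\mathcal L(x^*,y)\le\mathcal L(x^*,y^* )\le\mathcal L(x,y^* )$ for all $x\in\mathcal X,y\in\mathbb R^n$; it is assumed that at least one exists. It is assumed that $r$ is $\sigma$-strongly convex with $\sigma\ge0$: for all $x_1,x_2\in\mathcal X$ and every subgradient $r'(x_2)\in\partial r(x_2)$, $r(x_1)\ge r(x_2)+\langle r'(x_2),x_1-x_2\rangle+\frac\sigma2\|x_1-x_2\|^2$. For a positive integer $p$, $[p]=\{1,\dots,p\}$. The index set $[n]$ is partitioned into nonempty blocks $S^1,\dots,S^m$; $A^{S^j}$ is the submatrix of rows of $A$ indexed by $S^j$, $A^{S^j,T}$ denotes its transpose, and $y^{S^j},b^{S^j}$ are the corresponding subvectors. $\hat L=\max_{j\in[m]}\|A^{S^j}\|>0$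 (spectral norm), assumed given as input. $\|\cdot\|$ is the Euclidean norm for vectors. For convex $\phi$, $\mathrm{prox}_\phi(\hat x)=\arg\min_{x\in\mathcal X}\{\frac12\|x-\hat x\|^2+\phi(x)\}$. Algorithm CLVR. Input: $x_0\in\mathcal X$, $y_0\in\mathbb R^n$, $z_0=A^Ty_0$, $\gamma>0$, $\hat L>0$, $\sigma\ge0$, $K$, $m$, $S^1,\dots,S^m$. Set $a_1=A_1=\frac1{2\hat Lm}$, $q_0=a_1(z_0+c)$. (The scalars $A_k$ are distinct from the matrix $A$.) For $k=1,\dots,K$: (1) $x_k=\mathrm{prox}_{\frac1\gamma A_kr}(x_0-\frac1\gamma q_{k-1})$; (2) pick $j_k$ uniformly at random in $[m]$ (independently of the past); (3) $y_k^{S^{j_k}}=y_{k-1}^{S^{j_k}}+\gamma ma_k(A^{S^{j_k}}x_k-b^{S^{j_k}})$, and $y_k^{S^i}=y_{k-1}^{S^i}$ for $i\ne j_k$; (4) $a_{k+1}=\frac{\sqrt{1+\sigma A_k/\gamma}}{2\hat Lm}$, $A_{k+1}=A_k+a_{k+1}$; (5) $z_k=z_{k-1}+A^{S^{j_k},T}(y_k^{S^{j_k}}-y_{k-1}^{S^{j_k}})$; (6) $q_k=q_{k-1}+a_{k+1}(z_k+c)+ma_k(z_k-z_{k-1})$.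
   Formalization: The bound A_k ≥ k/(2L̂m) is proved for all k, but the second entry of the max only for k ≥ K_0; for k < K_0 the squared bracket can be negative inside and the claim fails (σ/(2L̂mγ)=90, k=1 would need A_1 ≥ 640/(2L̂m), while A_1=1/(2L̂m)). *)

theory Defs
  imports "HOL-Probability.Probability"
begin

definition subdifferential :: "('a::real_inner \<Rightarrow> real) \<Rightarrow> 'a \<Rightarrow> 'a set" where
  "subdifferential r x = {g. \<forall>u. r u \<ge> r x + g \<bullet> (u - x)}"

definition strongly_convex_on :: "real \<Rightarrow> 'a::real_inner set \<Rightarrow> ('a \<Rightarrow> real) \<Rightarrow> bool" where
  "strongly_convex_on \<sigma> X r \<longleftrightarrow>
     (\<forall>x1\<in>X. \<forall>x2\<in>X. \<forall>g\<in>subdifferential r x2.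
        r x1 \<ge> r x2 + g \<bullet> (x1 - x2) + \<sigma> / 2 * (norm (x1 - x2))\<^sup>2)"

text \<open>For \<open>X\<close> nonempty, closed and convex and \<open>\<phi>\<close> convex and finite on the whole space,
  the minimizer chosen here exists and is unique.\<close>

definition prox :: "'a::real_inner set \<Rightarrow> ('a \<Rightarrow> real) \<Rightarrow> 'a \<Rightarrow> 'a" where
  "prox X \<phi> xh = arg_min_on (\<lambda>x. 1 / 2 * (norm (x - xh))\<^sup>2 + \<phi> x) X"

definition lagrangian ::
  "real^'d \<Rightarrow> (real^'d \<Rightarrow> real) \<Rightarrow> real^'d^'n \<Rightarrow> real^'n \<Rightarrow> real^'d \<Rightarrow> real^'n \<Rightarrow> real" where
  "lagrangian c r A b x y = c \<bullet> x + r x + y \<bullet> (A *v x) - y \<bullet> b"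

definition nash_point ::
  "(real^'d) set \<Rightarrow> real^'d \<Rightarrow> (real^'d \<Rightarrow> real) \<Rightarrow> real^'d^'n \<Rightarrow> real^'n
    \<Rightarrow> real^'d \<Rightarrow> real^'n \<Rightarrow> bool" where
  "nash_point X c r A b xs ys \<longleftrightarrow> xs \<in> X \<and>
     (\<forall>x\<in>X. \<forall>y. lagrangian c r A b xs y \<le> lagrangian c r A b xs ys \<and>
                 lagrangian c r A b xs ys \<le> lagrangian c r A b x ys)"

text \<open>The subvector of \<open>v\<close>, respectively the row submatrix of \<open>A\<close>, indexed by \<open>S\<close> is
  represented in the full space by zero padding.  This changes neither Euclidean norms
  nor the spectral norm, and \<open>transpose (row_block S A) *v vec_block S v\<close> is the product of
  the transposed submatrix with the subvector.\<close>

definition vec_block :: "'n set \<Rightarrow> real^'n \<Rightarrow> real^'n" where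
  "vec_block S v = (\<chi> i. if i \<in> S then v $ i else 0)"

definition row_block :: "'n set \<Rightarrow> real^'d^'n \<Rightarrow> real^'d^'n" where
  "row_block S A = (\<chi> i. if i \<in> S then A $ i else 0)"

definition spectral_norm :: "real^'d^'n \<Rightarrow> real" where
  "spectral_norm A = onorm (\<lambda>x. A *v x)"

text \<open>The sequences \<open>x\<close>, \<open>y\<close>, \<open>z\<close>, \<open>q\<close> are the iterates of CLVR for the sequence \<open>j\<close> of
  selected blocks; \<open>Asc\<close> is the sequence of scalars \<open>A\<^sub>k\<close>.  The value \<open>x 0\<close> is the
  starting point.\<close>

definition clvr_run ::
  "(real^'d) set \<Rightarrow> real^'d \<Rightarrow> (real^'d \<Rightarrow> real) \<Rightarrow> real^'d^'n \<Rightarrow> real^'n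
    \<Rightarrow> real^'d \<Rightarrow> real^'n \<Rightarrow> real \<Rightarrow> real \<Rightarrow> real \<Rightarrow> nat \<Rightarrow> nat \<Rightarrow> (nat \<Rightarrow> 'n set)
    \<Rightarrow> (nat \<Rightarrow> nat) \<Rightarrow> (nat \<Rightarrow> real) \<Rightarrow> (nat \<Rightarrow> real)
    \<Rightarrow> (nat \<Rightarrow> real^'d) \<Rightarrow> (nat \<Rightarrow> real^'n) \<Rightarrow> (nat \<Rightarrow> real^'d) \<Rightarrow> (nat \<Rightarrow> real^'d) \<Rightarrow> bool" where
  "clvr_run X c r A b x0 y0 \<gamma> Lhat \<sigma> K m S j a Asc x y z q \<longleftrightarrow>
     x 0 = x0 \<and> y 0 = y0 \<and> z 0 = transpose A *v y0 \<and>
     a 1 = 1 / (2 * Lhat * real m) \<and> Asc 1 = 1 / (2 * Lhat * real m) \<and>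
     q 0 = a 1 *\<^sub>R (z 0 + c) \<and>
     (\<forall>k\<in>{1..K}.
        x k = prox X (\<lambda>u. 1 / \<gamma> * Asc k * r u) (x0 - (1 / \<gamma>) *\<^sub>R q (k - 1)) \<and>
        vec_block (S (j k)) (y k) = vec_block (S (j k)) (y (k - 1)) +
          (\<gamma> * real m * a k) *\<^sub>R (row_block (S (j k)) A *v x k - vec_block (S (j k)) b) \<and>
        (\<forall>i\<in>{1..m} - {j k}. vec_block (S i) (y k) = vec_block (S i) (y (k - 1))) \<and>
        a (k + 1) = sqrt (1 + \<sigma> * Asc k / \<gamma>) / (2 * Lhat * real m) \<and>
        Asc (k + 1) = Asc k + a (k + 1) \<and>
        z k = z (k - 1) + transpose (row_block (S (j k)) A) *v
          (vec_block (S (j k)) (y k) - vec_block (S (j k)) (y (k - 1))) \<and>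
        q k = q (k - 1) + a (k + 1) *\<^sub>R (z k + c) + (real m * a k) *\<^sub>R (z k - z (k - 1)))"

end

theory Submission
  imports Defs
begin

text \<open>The proof is an estimate-sequence argument that follows one run of the algorithm at a time and
takes expectations only at the end.

The vector \<open>q (k - 1)\<close> is the linear part of an estimate function \<open>\<phi> k\<close> which \<open>x k\<close> minimizes.  Since \<open>r\<close>
has subgradients everywhere, strong convexity gives \<open>\<phi> k\<close> quadratic growth around \<open>x k\<close> with modulus
\<open>\<gamma> + \<sigma> * Asc k\<close> (\<open>prox_growth\<close>).  The dual update is a gradient ascent step on one block of coordinates,
and the three-point identity for such a step (\<open>dual_step\<close>) telescopes up to a noise term, the error of
replacing the full residual \<open>A *v x k - b\<close> by \<open>m\<close> times a random block of it.  The two sides meet in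
one product, the extrapolation of the last dual step with \<open>A\<close> applied to the change of the primal
iterate.  The step sizes are chosen such that Young's inequality absorbs it into the primal growth and a
part of the squared dual steps (\<open>coupling_bound\<close>).  The outcome (\<open>gap_bound\<close>) bounds, for arbitrary \<open>u\<close> and
\<open>v\<close>, the gap plus the distances of \<open>(x k, y k)\<close> to \<open>(u, v)\<close> plus \<open>1 / (4 * \<gamma>)\<close> times the squared dual
steps by the initial distances plus the noise tested against \<open>v\<close>.

The noise is a martingale difference sequence, because the block drawn in a step is independent of the
iterates it acts on.  For the fixed point \<open>v = ys\<close> it has mean zero, and the gap at a Nash point is
nonnegative; this gives the bound on the distances, and also a bound on the expected squared dual steps.
The maximizer \<open>vh\<close> is random, so there the total noise has to be split off with Young's inequality.  This
costs a second copy of the distance of \<open>vh\<close> to \<open>y0\<close>, which explains the factor \<open>1 / \<gamma>\<close> instead of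
\<open>1 / (2 * \<gamma>)\<close>, and the variance of the noise, which is bounded by the expected squared dual steps
(\<open>accumulated_noise_variance\<close>) and hence by the distance of the Nash point to the starting point.

The growth of \<open>Asc\<close> is that of the recursion \<open>Asc (k + 1) = Asc k + sqrt (1 + s * Asc k) / B\<close>: at least
linear, and quadratic once the linear bound has reached \<open>s / (9 * B\<^sup>2)\<close>.\<close>

section \<open>Strong convexity and the proximal step\<close>

text \<open>A hyperplane separating \<open>(x, r x)\<close> from the strict epigraph is not vertical, because \<open>r\<close> is finite
everywhere; its slope is a subgradient.  Strong convexity in the sense of
\<^const>\<open>strongly_convex_on\<close> is a statement about subgradients, so it says something only
because they exist.\<close>

lemma subdifferential_nonempty:
  fixes r :: "'a::euclidean_space \<Rightarrow> real"
  assumes r: "convex_on UNIV r"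
  shows "subdifferential r x \<noteq> {}"
proof -
  define T where "T = {w :: 'a \<times> real. r (fst w) < snd w}"
  have "convex T"
  proof (rule convexI)
    fix w w' :: "'a \<times> real" and s t :: real
    assume w: "w \<in> T" "w' \<in> T" and st: "0 \<le> s" "0 \<le> t" "s + t = 1"
    have "r (s *\<^sub>R fst w + t *\<^sub>R fst w') \<le> s * r (fst w) + t * r (fst w')"
      using r st by (auto simp: convex_on_def)
    also have "\<dots> < s * snd w + t * snd w'"
    proof (cases "s = 0")
      case True
      then show ?thesis using st w by (simp add: T_def)
    next
      case False
      then have "s * r (fst w) < s * snd w" using st w by (simp add: T_def)
      moreover have "t * r (fst w') \<le> t * snd w'" using st w by (intro mult_left_mono) (auto simp: T_def)
      ultimately show ?thesis by linarith
    qed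
    finally show "s *\<^sub>R w + t *\<^sub>R w' \<in> T" by (simp add: T_def)
  qed
  moreover have "T \<noteq> {}"
  proof -
    have "(x, r x + 1) \<in> T" by (simp add: T_def)
    then show ?thesis by blast
  qed
  moreover have "{(x, r x)} \<inter> T = {}" by (auto simp: T_def)
  ultimately obtain h d where h: "h \<noteq> 0" "h \<bullet> (x, r x) \<le> d" "\<forall>w\<in>T. d \<le> h \<bullet> w"
    using separating_hyperplane_sets[of "{(x, r x)}" T] by auto
  obtain p s where hps: "h = (p, s)" by (cases h)
  have sep: "p \<bullet> x + s * r x \<le> p \<bullet> u + s * t" if "r u < t" for u t
    using h(2,3) that by (force simp: T_def hps)
  have "s \<ge> 0" using sep[of x "r x + 1"] by (simp add: algebra_simps)
  \<comment> \<open>A vertical hyperplane has a base point such as \<open>x - p\<close> on its wrong side.\<close>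
  moreover have "s \<noteq> 0"
  proof
    assume "s = 0"
    then have "p \<bullet> x \<le> p \<bullet> (x - p)" using sep[of "x - p" "r (x - p) + 1"] by simp
    then have "p \<bullet> p \<le> 0" by (simp add: inner_diff_right)
    then have "p = 0" using inner_ge_zero[of p] inner_eq_zero_iff[of p] by linarith
    then show False using h(1) hps \<open>s = 0\<close> by (simp add: zero_prod_def)
  qed
  ultimately have s: "s > 0" by simp
  have "r x + (- (1 / s) *\<^sub>R p) \<bullet> (u - x) \<le> r u" for u
  proof (rule field_le_epsilon)
    fix e :: real assume "e > 0"
    then have "p \<bullet> x + s * r x \<le> p \<bullet> u + s * (r u + e)" using sep[of u "r u + e"] by simp
    then have "s * (r x + (- (1 / s) *\<^sub>R p) \<bullet> (u - x)) \<le> s * (r u + e)"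
      using s by (simp add: inner_diff_right algebra_simps)
    then show "r x + (- (1 / s) *\<^sub>R p) \<bullet> (u - x) \<le> r u + e" using s by simp
  qed
  then have "- (1 / s) *\<^sub>R p \<in> subdifferential r x" unfolding subdifferential_def by blast
  then show ?thesis by blast
qed

text \<open>The quadratic form of strong convexity along a segment: the two subgradient inequalities at the
intermediate point are averaged, and the linear terms cancel.\<close>

lemma strongly_convex_on_segment:
  fixes r :: "'a::euclidean_space \<Rightarrow> real"
  assumes r: "convex_on UNIV r" and sc: "strongly_convex_on \<sigma> X r" and X: "convex X"
    and p: "p \<in> X" and u: "u \<in> X" and s: "0 \<le> s" "s \<le> 1"
  shows "r ((1 - s) *\<^sub>R p + s *\<^sub>R u)
    \<le> (1 - s) * r p + s * r u - \<sigma> / 2 * (s * (1 - s)) * (norm (u - p))\<^sup>2"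
proof -
  define w where "w = (1 - s) *\<^sub>R p + s *\<^sub>R u"
  have w: "w \<in> X" unfolding w_def using X p u s by (simp add: convexD)
  obtain g where g: "g \<in> subdifferential r w" using subdifferential_nonempty[OF r] by blast
  have e: "p - w = - (s *\<^sub>R (u - p))" "u - w = (1 - s) *\<^sub>R (u - p)"
    unfolding w_def by (simp_all add: algebra_simps)
  have 1: "r w + g \<bullet> (p - w) + \<sigma> / 2 * (norm (p - w))\<^sup>2 \<le> r p"
    and 2: "r w + g \<bullet> (u - w) + \<sigma> / 2 * (norm (u - w))\<^sup>2 \<le> r u"
    using sc p u w g by (auto simp: strongly_convex_on_def)
  have "(1 - s) * (r w + g \<bullet> (p - w) + \<sigma> / 2 * (norm (p - w))\<^sup>2)
      + s * (r w + g \<bullet> (u - w) + \<sigma> / 2 * (norm (u - w))\<^sup>2) \<le> (1 - s) * r p + s * r u"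
    using 1 2 s by (intro add_mono mult_left_mono) auto
  moreover have "(1 - s) * (r w + g \<bullet> (p - w) + \<sigma> / 2 * (norm (p - w))\<^sup>2)
      + s * (r w + g \<bullet> (u - w) + \<sigma> / 2 * (norm (u - w))\<^sup>2)
      = r w + \<sigma> / 2 * (s * (1 - s)) * (norm (u - p))\<^sup>2"
    unfolding e by (simp add: power_mult_distrib) (simp add: field_simps power2_eq_square)
  ultimately show ?thesis by (simp add: w_def)
qed

lemma norm_convex_combination:
  fixes P U :: "'a::real_inner"
  shows "(norm ((1 - s) *\<^sub>R P + s *\<^sub>R U))\<^sup>2
    = (1 - s) * (norm P)\<^sup>2 + s * (norm U)\<^sup>2 - s * (1 - s) * (norm (U - P))\<^sup>2"
  unfolding power2_norm_eq_inner
  by (simp add: inner_diff_left inner_diff_right inner_add_left inner_add_right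
        inner_commute[of U P] power2_eq_square) (simp add: field_simps)

text \<open>A strongly convex function exceeds its minimum by at least the quadratic of its modulus; here the
proximal term contributes \<open>1\<close> and \<open>t * r\<close> contributes \<open>\<sigma> * t\<close> to the modulus.  The choice operator
inside \<^const>\<open>prox\<close> requires that a minimizer exists: a subgradient at \<open>x0\<close> bounds the objective
below by a paraboloid, so that sublevel sets are compact.\<close>

lemma prox_growth:
  fixes r :: "'a::euclidean_space \<Rightarrow> real" and xh u :: 'a
  assumes X: "closed X" "convex X" and x0: "x0 \<in> X"
    and r: "convex_on UNIV r" and sc: "strongly_convex_on \<sigma> X r" and t: "t \<ge> 0"
  defines "p \<equiv> prox X (\<lambda>u. t * r u) xh"
  shows "p \<in> X"
    and "u \<in> X \<Longrightarrow> 1 / 2 * (norm (p - xh))\<^sup>2 + t * r p + (1 + \<sigma> * t) / 2 * (norm (u - p))\<^sup>2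
           \<le> 1 / 2 * (norm (u - xh))\<^sup>2 + t * r u"
proof -
  define f where "f u = 1 / 2 * (norm (u - xh))\<^sup>2 + t * r u" for u
  have cont: "continuous_on UNIV f"
    unfolding f_def using convex_on_continuous[OF open_UNIV r] by (intro continuous_intros)
  obtain g where g: "g \<in> subdifferential r x0" using subdifferential_nonempty[OF r] by blast
  have low: "1 / 2 * (norm (u - (xh - t *\<^sub>R g)))\<^sup>2
      + (t * r x0 + t * (g \<bullet> (xh - x0)) - 1 / 2 * (t\<^sup>2 * (norm g)\<^sup>2)) \<le> f u" for u
  proof -
    have "t * (r x0 + g \<bullet> (u - x0)) \<le> t * r u"
      using g t by (intro mult_left_mono) (auto simp: subdifferential_def)
    moreover have "(norm (u - (xh - t *\<^sub>R g)))\<^sup>2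
        = (norm (u - xh))\<^sup>2 + 2 * t * (g \<bullet> (u - xh)) + t\<^sup>2 * (norm g)\<^sup>2"
      using dot_norm[of "u - xh" "t *\<^sub>R g"]
      by (simp add: power_mult_distrib inner_commute algebra_simps)
    ultimately show ?thesis unfolding f_def
      by (simp add: inner_diff_right algebra_simps)
  qed
  define L where "L = X \<inter> {u. f u \<le> f x0}"
  have "bounded L"
  proof (rule bounded_subset[OF bounded_cball])
    define C where "C = 2 * (f x0 - (t * r x0 + t * (g \<bullet> (xh - x0)) - 1 / 2 * (t\<^sup>2 * (norm g)\<^sup>2)))"
    show "L \<subseteq> cball (xh - t *\<^sub>R g) (sqrt C)"
    proof
      fix u assume "u \<in> L"
      then have "(norm (u - (xh - t *\<^sub>R g)))\<^sup>2 \<le> C" using low[of u] by (simp add: L_def C_def)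
      then have "norm (u - (xh - t *\<^sub>R g)) \<le> sqrt C" using real_le_rsqrt by blast
      then show "u \<in> cball (xh - t *\<^sub>R g) (sqrt C)"
        by (simp add: dist_norm norm_minus_commute)
    qed
  qed
  moreover have "closed {u. f u \<le> f x0}"
    using cont by (intro closed_Collect_le) (auto intro: continuous_intros)
  then have "closed L" unfolding L_def using X by (intro closed_Int)
  ultimately have "compact L" by (simp add: compact_eq_bounded_closed)
  moreover have "x0 \<in> L" using x0 by (simp add: L_def)
  ultimately obtain v where v: "v \<in> L" "\<forall>u\<in>L. f v \<le> f u"
    using continuous_attains_inf[of L f] cont continuous_on_subset by blast
  have "f v \<le> f x0" using v(1) by (simp add: L_def)
  then have vmin: "f v \<le> f u" if "u \<in> X" for u
    using v(2) that by (cases "f u \<le> f x0") (auto simp: L_def)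
  have "is_arg_min f (\<lambda>u. u \<in> X) v"
    using v(1) vmin by (force simp: is_arg_min_def L_def not_less)
  then have "is_arg_min f (\<lambda>u. u \<in> X) p"
    unfolding p_def prox_def arg_min_on_def arg_min_def f_def[symmetric] by (rule someI)
  then have pX: "p \<in> X" and pmin: "\<And>u. u \<in> X \<Longrightarrow> f p \<le> f u"
    by (auto simp: is_arg_min_def not_less)
  show "p \<in> X" by (rule pX)
  show "1 / 2 * (norm (p - xh))\<^sup>2 + t * r p + (1 + \<sigma> * t) / 2 * (norm (u - p))\<^sup>2
      \<le> 1 / 2 * (norm (u - xh))\<^sup>2 + t * r u" if u: "u \<in> X"
  proof -
    \<comment> \<open>Comparing \<open>p\<close> with the point at fraction \<open>s = 1 - z\<close> towards \<open>u\<close> gives the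
      bound up to the factor \<open>z\<close>; then \<open>z\<close> tends to \<open>1\<close>.\<close>
    have "z * ((1 + \<sigma> * t) / 2 * (norm (u - p))\<^sup>2) \<le> f u - f p" if z: "0 < z" "z < 1" for z
    proof -
      define s where "s = 1 - z"
      have s: "0 < s" "s < 1" "z = 1 - s" using z by (auto simp: s_def)
      define w where "w = (1 - s) *\<^sub>R p + s *\<^sub>R u"
      have "w \<in> X" unfolding w_def using X pX u s by (simp add: convexD)
      have sq: "(norm (w - xh))\<^sup>2
          = (1 - s) * (norm (p - xh))\<^sup>2 + s * (norm (u - xh))\<^sup>2 - s * (1 - s) * (norm (u - p))\<^sup>2"
        using norm_convex_combination[of s "p - xh" "u - xh"]
        unfolding w_def by (simp add: algebra_simps)
      have rw: "t * r w \<le> t * ((1 - s) * r p + s * r u - \<sigma> / 2 * (s * (1 - s)) * (norm (u - p))\<^sup>2)"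
        unfolding w_def using strongly_convex_on_segment[OF r sc X(2) pX u, of s] s t
        by (intro mult_left_mono) auto
      have "f p \<le> f w" by (rule pmin[OF \<open>w \<in> X\<close>])
      also have "\<dots> \<le> (1 - s) * f p + s * f u - s * (z * ((1 + \<sigma> * t) / 2 * (norm (u - p))\<^sup>2))"
        using rw unfolding f_def sq s(3) by (simp add: field_simps)
      finally have "s * (z * ((1 + \<sigma> * t) / 2 * (norm (u - p))\<^sup>2)) \<le> s * (f u - f p)"
        by (simp add: algebra_simps)
      then show ?thesis using s by simp
    qed
    then have "(1 + \<sigma> * t) / 2 * (norm (u - p))\<^sup>2 \<le> f u - f p"
      by (rule field_le_mult_one_interval)
    then show ?thesis by (simp add: f_def)
  qed
qed

section \<open>Growth of the step sizes\<close>

lemma scalar_growth: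
  fixes Asc :: "nat \<Rightarrow> real"
  assumes B: "B > 0" and s: "s \<ge> 0"
    and one: "Asc 1 = 1 / B"
    and step: "\<And>k. 1 \<le> k \<Longrightarrow> k < K \<Longrightarrow> Asc (k + 1) = Asc k + sqrt (1 + s * Asc k) / B"
    and k: "1 \<le> k" "k \<le> K"
  shows "real k / B \<le> Asc k"
  using k
proof (induction k rule: dec_induct)
  case base
  then show ?case using one by simp
next
  case (step n)
  then have IH: "real n / B \<le> Asc n" by simp
  have "0 \<le> Asc n" using IH B by (meson divide_nonneg_pos of_nat_0_le_iff order_trans)
  then have "1 \<le> sqrt (1 + s * Asc n)" using s by simp
  then have "1 / B \<le> sqrt (1 + s * Asc n) / B" using B by (simp add: divide_right_mono)
  then have "real n / B + 1 / B \<le> Asc n + sqrt (1 + s * Asc n) / B" using IH by linarith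
  then show ?case using assms(4)[of n] step by (simp add: add_divide_distrib)
qed

text \<open>If \<open>Asc k \<ge> s / (9 * B\<^sup>2) * \<tau>\<^sup>2\<close>, then one step adds at least \<open>s / (9 * B\<^sup>2) * 3 * \<tau>\<close>, which turns
\<open>\<tau>\<^sup>2\<close> into at least \<open>(\<tau> + 1)\<^sup>2\<close> as soon as \<open>\<tau> \<ge> 1\<close>.  The induction starts at \<open>k0\<close>, where the linear
bound already dominates: \<open>k0 / B\<close> is at least both \<open>s / (9 * B) / B\<close> and \<open>1 / B\<close>, and these are the values
of the quadratic bound for the two arguments of \<open>max\<close>.\<close>

lemma scalar_quadratic_growth:
  fixes Asc :: "nat \<Rightarrow> real"
  assumes B: "B > 0" and s: "s > 0"
    and one: "Asc 1 = 1 / B"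
    and step: "\<And>k. 1 \<le> k \<Longrightarrow> k < K \<Longrightarrow> Asc (k + 1) = Asc k + sqrt (1 + s * Asc k) / B"
    and k0: "int k0 = \<lceil>s / (9 * B)\<rceil>"
    and k: "k0 \<le> k" "k \<le> K"
  shows "s / (9 * B\<^sup>2) * (real k - real k0 + max (3 * sqrt (B / s)) 1)\<^sup>2 \<le> Asc k"
proof -
  have "0 < s / (9 * B)" using B s by simp
  then have "0 < \<lceil>s / (9 * B)\<rceil>" by simp
  then have "int 1 \<le> int k0" unfolding k0 by linarith
  then have k01: "1 \<le> k0" by linarith
  define t0 where "t0 = max (3 * sqrt (B / s)) 1"
  show ?thesis
    unfolding t0_def[symmetric] using k
  proof (induction k rule: dec_induct)
    case base
    have k0r: "s / (9 * B) \<le> real k0" using k0 by (metis le_of_int_ceiling of_int_of_nat_eq)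
    have "s / (9 * B\<^sup>2) * t0\<^sup>2 \<le> real k0 / B"
    proof (cases "3 * sqrt (B / s) \<le> 1")
      case True
      then have "s / (9 * B\<^sup>2) * t0\<^sup>2 = s / (9 * B) / B" by (simp add: t0_def power2_eq_square)
      also have "\<dots> \<le> real k0 / B" using k0r B by (intro divide_right_mono) auto
      finally show ?thesis .
    next
      case False
      then have "s / (9 * B\<^sup>2) * t0\<^sup>2 = 1 / B"
        using B s by (simp add: t0_def power_mult_distrib power2_eq_square field_simps)
      also have "\<dots> \<le> real k0 / B" using k01 B by (intro divide_right_mono) auto
      finally show ?thesis .
    qed
    also have "\<dots> \<le> Asc k0"
      using scalar_growth[OF B _ one assms(4) k01] s base by simp
    finally show ?case by simp
  next
    case (step n)
    define \<tau> where "\<tau> = real n - real k0 + t0"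
    have \<tau>: "\<tau> \<ge> 1" using step by (simp add: \<tau>_def t0_def)
    have IH: "s / (9 * B\<^sup>2) * \<tau>\<^sup>2 \<le> Asc n" using step by (simp add: \<tau>_def)
    have "(s * \<tau> / (3 * B))\<^sup>2 = s * (s / (9 * B\<^sup>2) * \<tau>\<^sup>2)"
      by (simp add: power2_eq_square field_simps)
    also have "\<dots> \<le> 1 + s * Asc n" using mult_left_mono[OF IH, of s] s by linarith
    finally have "s * \<tau> / (3 * B) \<le> sqrt (1 + s * Asc n)" by (rule real_le_rsqrt)
    then have "s * \<tau> / (3 * B) / B \<le> sqrt (1 + s * Asc n) / B"
      using B by (intro divide_right_mono) auto
    then have "s / (9 * B\<^sup>2) * \<tau>\<^sup>2 + s * \<tau> / (3 * B) / B \<le> Asc n + sqrt (1 + s * Asc n) / B"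
      using IH by linarith
    moreover have "s / (9 * B\<^sup>2) * \<tau>\<^sup>2 + s * \<tau> / (3 * B) / B = s / (9 * B\<^sup>2) * (\<tau>\<^sup>2 + 3 * \<tau>)"
      using B by (simp add: field_simps power2_eq_square)
    moreover have "s / (9 * B\<^sup>2) * (\<tau> + 1)\<^sup>2 \<le> s / (9 * B\<^sup>2) * (\<tau>\<^sup>2 + 3 * \<tau>)"
      using s \<tau> by (intro mult_left_mono) (auto simp: power2_eq_square algebra_simps)
    moreover have e: "real (Suc n) - real k0 + t0 = \<tau> + 1" by (simp add: \<tau>_def)
    ultimately have "s / (9 * B\<^sup>2) * (real (Suc n) - real k0 + t0)\<^sup>2
        \<le> Asc n + sqrt (1 + s * Asc n) / B" unfolding e by linarith
    then show ?case using assms(4)[of n] step k01 by simp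
  qed
qed

section \<open>Row blocks\<close>

lemma vec_block_diff: "vec_block T (u - v) = vec_block T u - vec_block T v"
  by (simp add: vec_block_def vec_eq_iff)

lemma vec_block_idem: "vec_block T (vec_block T v) = vec_block T v"
  by (simp add: vec_block_def vec_eq_iff)

lemma inner_vec_block: "vec_block T u \<bullet> v = u \<bullet> vec_block T v"
  by (auto simp: vec_block_def inner_vec_def intro!: sum.cong)

lemma inner_vec_block_idem: "vec_block T u \<bullet> vec_block T v = u \<bullet> vec_block T v"
  by (simp add: inner_vec_block vec_block_idem)

lemma row_block_mult: "row_block T A *v h = vec_block T (A *v h)"
  by (auto simp: row_block_def vec_block_def matrix_vector_mult_def vec_eq_iff)

lemma transpose_row_block_mult:
  "transpose (row_block T A) *v w = transpose A *v vec_block T w"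
  by (auto simp: row_block_def vec_block_def matrix_vector_mult_def vec_eq_iff transpose_def
      intro!: sum.cong)

lemma inner_transpose_mult:
  fixes A :: "real^'d^'n"
  shows "(transpose A *v w) \<bullet> u = w \<bullet> (A *v u)"
  by (simp add: dot_lmul_matrix)

lemma norm_row_block_mult_le: "norm (row_block T A *v h) \<le> spectral_norm (row_block T A) * norm h"
  unfolding spectral_norm_def by (rule onorm) (simp add: matrix_vector_mul_bounded_linear)

locale clvr_problem =
  fixes X :: "(real^'d) set" and c :: "real^'d" and r :: "real^'d \<Rightarrow> real"
    and A :: "real^'d^'n" and b :: "real^'n"
    and x0 :: "real^'d" and y0 :: "real^'n"
    and \<gamma> Lhat \<sigma> :: real and K m :: nat and S :: "nat \<Rightarrow> 'n set"
  assumes X: "closed X" "convex X"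
    and r: "convex_on UNIV r"
    and sigma: "\<sigma> \<ge> 0" "strongly_convex_on \<sigma> X r"
    and blocks: "inj_on S {1..m}" "partition_on UNIV (S ` {1..m})"
    and Lhat: "Lhat = Max ((\<lambda>i. spectral_norm (row_block (S i) A)) ` {1..m})" "Lhat > 0"
    and init: "x0 \<in> X" "\<gamma> > 0"
begin

lemma block_of_index: "\<exists>i\<in>{1..m}. n \<in> S i"
  using partition_onD1[OF blocks(2)] by blast

lemma block_unique: "i \<in> {1..m} \<Longrightarrow> i' \<in> {1..m} \<Longrightarrow> n \<in> S i \<Longrightarrow> n \<in> S i' \<Longrightarrow> i = i'"
  using disjointD[OF partition_onD2[OF blocks(2)], of "S i" "S i'"] inj_onD[OF blocks(1), of i i']
  by (metis IntI empty_iff imageI)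

lemma m_pos: "m > 0"
  using block_of_index[of undefined] by auto

lemma sum_vec_block: "(\<Sum>i=1..m. vec_block (S i) v) = v"
proof (rule vec_eq_iff[THEN iffD2], rule allI)
  fix n
  obtain i where i: "i \<in> {1..m}" "n \<in> S i" using block_of_index by blast
  have mem: "n \<in> S l \<longleftrightarrow> l = i" if "l \<in> {1..m}" for l
    using block_unique[OF that i(1)] i(2) by blast
  have "(\<Sum>l=1..m. vec_block (S l) v) $ n = (\<Sum>l\<in>{1..m}. if l = i then v $ n else 0)"
    unfolding sum_component using mem by (intro sum.cong) (simp_all add: vec_block_def)
  then show "(\<Sum>l=1..m. vec_block (S l) v) $ n = v $ n" using i by simp
qed

text \<open>Distinct blocks are orthogonal, so this is the theorem of Pythagoras.  It is what makes the second
moments of a uniformly chosen block computable.\<close>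

lemma sum_norm_vec_block: "(\<Sum>i=1..m. (norm (vec_block (S i) v))\<^sup>2) = (norm v)\<^sup>2"
proof -
  have "(\<Sum>i=1..m. (norm (vec_block (S i) v))\<^sup>2) = v \<bullet> (\<Sum>i=1..m. vec_block (S i) v)"
    by (simp add: power2_norm_eq_inner inner_vec_block_idem inner_sum_right)
  then show ?thesis by (simp only: sum_vec_block power2_norm_eq_inner)
qed

lemma norm_block_mult_le:
  assumes "i \<in> {1..m}"
  shows "norm (vec_block (S i) (A *v h)) \<le> Lhat * norm h"
proof -
  have "spectral_norm (row_block (S i) A) \<le> Lhat"
    unfolding Lhat(1) using assms by (intro Max_ge) auto
  then have "spectral_norm (row_block (S i) A) * norm h \<le> Lhat * norm h"
    by (intro mult_right_mono) auto
  then show ?thesis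
    using norm_row_block_mult_le[of "S i" A h] by (simp add: row_block_mult)
qed

lemma block_update:
  assumes i: "i \<in> {1..m}"
    and own: "vec_block (S i) v = vec_block (S i) w + vec_block (S i) d"
    and other: "\<And>l. l \<in> {1..m} - {i} \<Longrightarrow> vec_block (S l) v = vec_block (S l) w"
  shows "v = w + vec_block (S i) d"
proof (rule vec_eq_iff[THEN iffD2], rule allI)
  fix n
  obtain l where l: "l \<in> {1..m}" "n \<in> S l" using block_of_index by blast
  show "v $ n = (w + vec_block (S i) d) $ n"
  proof (cases "l = i")
    case True
    then show ?thesis using arg_cong[OF own, of "\<lambda>v. v $ n"] l by (simp add: vec_block_def)
  next
    case False
    then have "n \<notin> S i" using block_unique[OF l(1) i l(2)] by blast
    then show ?thesis using arg_cong[OF other[of l], of "\<lambda>v. v $ n"] l False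
      by (simp add: vec_block_def)
  qed
qed

end

section \<open>The gap along a single run\<close>

text \<open>A single run, for a fixed sequence \<open>j\<close> of selected blocks.  Everything up to the bound on the gap holds
run by run; chance enters only through the noise terms that this bound carries.\<close>

locale clvr_path = clvr_problem X c r A b x0 y0 \<gamma> Lhat \<sigma> K m S
  for X :: "(real^'d) set" and c :: "real^'d" and r :: "real^'d \<Rightarrow> real"
    and A :: "real^'d^'n" and b :: "real^'n"
    and x0 :: "real^'d" and y0 :: "real^'n"
    and \<gamma> Lhat \<sigma> :: real and K m :: nat and S :: "nat \<Rightarrow> 'n set" +
  fixes j :: "nat \<Rightarrow> nat" and a Asc :: "nat \<Rightarrow> real"
    and x :: "nat \<Rightarrow> real^'d" and y :: "nat \<Rightarrow> real^'n" and z q :: "nat \<Rightarrow> real^'d"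
  assumes run: "clvr_run X c r A b x0 y0 \<gamma> Lhat \<sigma> K m S j a Asc x y z q"
    and j_range: "\<And>k. k \<in> {1..K} \<Longrightarrow> j k \<in> {1..m}"
begin

text \<open>\<open>Y k\<close> is \<open>s k\<close> times the averaged dual point, and \<open>D k\<close> is the extrapolation that the last step
contributes to \<open>Y k\<close> but not yet to the vector \<open>q (k - 1)\<close> that determines \<open>x k\<close>.  Index \<open>0\<close> is
harmless: \<open>0 - 1 = 0\<close> on naturals makes \<open>dy 0\<close>, and with it \<open>D 0\<close>, vanish whatever the value of \<open>a 0\<close>.\<close>

definition dy :: "nat \<Rightarrow> real^'n" where "dy k = y k - y (k - 1)"

definition D :: "nat \<Rightarrow> real^'n" where "D k = (real m * a k) *\<^sub>R dy k"

definition Y :: "nat \<Rightarrow> real^'n" where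
  "Y k = (\<Sum>i=1..k. a i *\<^sub>R y i + ((real m - 1) * a i) *\<^sub>R (y i - y (i - 1)))"

definition G :: "nat \<Rightarrow> real^'n" where "G k = A *v x k - b"

text \<open>Scaled by \<open>m\<close>, a random block of the residual \<open>G k\<close> is an unbiased estimate of \<open>G k\<close>; this is
\<open>a k\<close> times its error.\<close>

definition noise :: "nat \<Rightarrow> real^'n" where
  "noise k = a k *\<^sub>R (G k - real m *\<^sub>R vec_block (S (j k)) (G k))"

definition s :: "nat \<Rightarrow> real" where "s k = (\<Sum>i=1..k. a i)"

text \<open>The estimate function that \<open>x k\<close> minimizes over \<open>X\<close>.  Its linear part is \<open>q (k - 1)\<close>, written in terms
of the averaged dual point (see \<open>q_eq\<close> below).\<close>

definition \<phi> :: "nat \<Rightarrow> real^'d \<Rightarrow> real" where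
  "\<phi> k u = (s k *\<^sub>R c + transpose A *v (Y k - D k)) \<bullet> u + \<gamma> / 2 * (norm (u - x0))\<^sup>2 + s k * r u"

lemma start: "x 0 = x0" "y 0 = y0" "z 0 = transpose A *v y0"
    "a 1 = 1 / (2 * Lhat * real m)" "Asc 1 = 1 / (2 * Lhat * real m)"
    "q 0 = a 1 *\<^sub>R (transpose A *v y0 + c)"
  using run by (simp_all add: clvr_run_def)

lemma run_step:
  assumes "k \<in> {1..K}"
  shows x_step: "x k = prox X (\<lambda>u. 1 / \<gamma> * Asc k * r u) (x0 - (1 / \<gamma>) *\<^sub>R q (k - 1))"
    and y_step: "y k = y (k - 1) + (\<gamma> * real m * a k) *\<^sub>R vec_block (S (j k)) (G k)"
    and a_step: "a (Suc k) = sqrt (1 + \<sigma> * Asc k / \<gamma>) / (2 * Lhat * real m)"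
    and Asc_step: "Asc (Suc k) = Asc k + a (Suc k)"
    and z_step: "z k = z (k - 1) + transpose A *v dy k"
    and q_step: "q k = q (k - 1) + a (Suc k) *\<^sub>R (z k + c) + (real m * a k) *\<^sub>R (z k - z (k - 1))"
proof -
  note R = run[unfolded clvr_run_def] assms
  show "x k = prox X (\<lambda>u. 1 / \<gamma> * Asc k * r u) (x0 - (1 / \<gamma>) *\<^sub>R q (k - 1))"
    "a (Suc k) = sqrt (1 + \<sigma> * Asc k / \<gamma>) / (2 * Lhat * real m)"
    "Asc (Suc k) = Asc k + a (Suc k)"
    "q k = q (k - 1) + a (Suc k) *\<^sub>R (z k + c) + (real m * a k) *\<^sub>R (z k - z (k - 1))"
    using R by (simp_all only: Suc_eq_plus1)
  have own: "vec_block (S (j k)) (y k) = vec_block (S (j k)) (y (k - 1)) +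
      (\<gamma> * real m * a k) *\<^sub>R (row_block (S (j k)) A *v x k - vec_block (S (j k)) b)"
    and other: "\<forall>i\<in>{1..m} - {j k}. vec_block (S i) (y k) = vec_block (S i) (y (k - 1))"
    and zk: "z k = z (k - 1) + transpose (row_block (S (j k)) A) *v
          (vec_block (S (j k)) (y k) - vec_block (S (j k)) (y (k - 1)))"
    using R by blast+
  have sc: "(\<gamma> * real m * a k) *\<^sub>R vec_block (S (j k)) v
      = vec_block (S (j k)) ((\<gamma> * real m * a k) *\<^sub>R v)" for v
    by (simp add: vec_block_def vec_eq_iff)
  have own': "vec_block (S (j k)) (y k)
      = vec_block (S (j k)) (y (k - 1)) + vec_block (S (j k)) ((\<gamma> * real m * a k) *\<^sub>R G k)"
    using own by (simp only: sc[symmetric] G_def row_block_mult vec_block_diff)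
  show y: "y k = y (k - 1) + (\<gamma> * real m * a k) *\<^sub>R vec_block (S (j k)) (G k)"
    unfolding sc by (rule block_update[OF j_range[OF assms] own']) (rule other[rule_format])
  have "dy k = vec_block (S (j k)) ((\<gamma> * real m * a k) *\<^sub>R G k)"
    unfolding dy_def sc[symmetric] diff_eq_eq by (subst add.commute) (rule y)
  then have "vec_block (S (j k)) (dy k) = dy k" by (simp only: vec_block_idem)
  then show "z k = z (k - 1) + transpose A *v dy k"
    using zk by (simp only: transpose_row_block_mult vec_block_diff[symmetric] vec_block_idem
        dy_def[symmetric])
qed

lemma dy_0 [simp]: "dy 0 = 0" by (simp add: dy_def)
lemma D_0 [simp]: "D 0 = 0" by (simp add: D_def)
lemma Y_0 [simp]: "Y 0 = 0" by (simp add: Y_def)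
lemma s_0 [simp]: "s 0 = 0" by (simp add: s_def)
lemma s_Suc: "s (Suc k) = s k + a (Suc k)" by (simp add: s_def)

lemma Asc_eq: "k \<in> {1..K} \<Longrightarrow> Asc k = s k"
proof (induction k)
  case (Suc k)
  show ?case
  proof (cases "k = 0")
    case True
    then show ?thesis using start by (simp add: s_Suc)
  next
    case False
    then show ?thesis using Suc Asc_step[of k] by (simp add: s_Suc)
  qed
qed simp

lemma a_eq:
  assumes "Suc k \<in> {1..K}"
  shows "a (Suc k) = sqrt (1 + \<sigma> * s k / \<gamma>) / (2 * Lhat * real m)"
proof (cases "k = 0")
  case True
  then show ?thesis using start by simp
next
  case False
  then show ?thesis using assms a_step[of k] Asc_eq[of k] by simp
qed

lemma a_s_pos: "k \<le> K \<Longrightarrow> 0 \<le> s k \<and> (0 < k \<longrightarrow> 0 < a k \<and> 0 < s k)"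
proof (induction k)
  case (Suc k)
  then have "0 \<le> s k" by simp
  then have "0 \<le> \<sigma> * s k / \<gamma>" using sigma init by simp
  then have "0 < a (Suc k)" using a_eq[of k] Suc Lhat m_pos by simp
  then show ?case using \<open>0 \<le> s k\<close> by (simp add: s_Suc)
qed simp

lemma z_eq: "k \<le> K \<Longrightarrow> z k = transpose A *v y k"
proof (induction k)
  case 0
  then show ?case using start by simp
next
  case (Suc k)
  then have "z (Suc k) = transpose A *v y k + transpose A *v dy (Suc k)" using z_step[of "Suc k"] by simp
  then show ?case by (simp add: dy_def matrix_vector_right_distrib[symmetric] del: transpose_matrix_vector)
qed

lemma Y_Suc: "Y (Suc k) = Y k + (a (Suc k) *\<^sub>R y k + D (Suc k))"
  by (simp add: Y_def D_def dy_def algebra_simps)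

text \<open>The update of \<open>q\<close> is designed so that \<open>q\<close> tracks the linear part, in the primal variable, of \<open>s\<close> times the
Lagrangian at the averaged dual point, except for the extrapolation of the most recent step.\<close>

lemma q_eq: "Suc k \<le> K \<Longrightarrow> q k = s (Suc k) *\<^sub>R c + transpose A *v (Y (Suc k) - D (Suc k))"
proof (induction k)
  case 0
  then show ?case
    using start by (simp add: s_Suc Y_Suc algebra_simps matrix_vector_mult_scaleR del: transpose_matrix_vector)
next
  case (Suc k)
  have "q (Suc k) = q k + a (Suc (Suc k)) *\<^sub>R (z (Suc k) + c) + transpose A *v D (Suc k)"
    using Suc q_step[of "Suc k"] z_eq[of "Suc k"] z_eq[of k]
    by (simp add: D_def dy_def matrix_vector_mult_scaleR matrix_vector_mult_diff_distrib
        del: transpose_matrix_vector)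
  then show ?case
    using Suc z_eq[of "Suc k"]
    by (simp add: s_Suc Y_Suc[of "Suc k"] algebra_simps matrix_vector_mult_scaleR matrix_vector_mult_diff_distrib
        matrix_vector_right_distrib del: transpose_matrix_vector)
qed

lemma \<phi>_growth:
  assumes "k \<le> K"
  shows x_in_X: "x k \<in> X"
    and \<phi>_min: "u \<in> X \<Longrightarrow> \<phi> k (x k) + (\<gamma> + \<sigma> * s k) / 2 * (norm (u - x k))\<^sup>2 \<le> \<phi> k u"
proof -
  have "x k \<in> X \<and> (u \<in> X \<longrightarrow> \<phi> k (x k) + (\<gamma> + \<sigma> * s k) / 2 * (norm (u - x k))\<^sup>2 \<le> \<phi> k u)"
  proof (cases k)
    case 0
    then show ?thesis using start init by (simp add: \<phi>_def)
  next
    case (Suc n)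
    define Q where "Q = q n"
    define t where "t = 1 / \<gamma> * s k"
    have t: "t \<ge> 0" using a_s_pos[OF assms] init by (simp add: t_def)
    have xk: "x k = prox X (\<lambda>u. t * r u) (x0 - (1 / \<gamma>) *\<^sub>R Q)"
      using x_step[of k] Asc_eq[of k] assms Suc by (simp add: t_def Q_def)
    note P = prox_growth[OF X init(1) r sigma(2) t, where xh = "x0 - (1 / \<gamma>) *\<^sub>R Q", folded xk]
    have f: "\<phi> k w = \<gamma> * (1 / 2 * (norm (w - (x0 - (1 / \<gamma>) *\<^sub>R Q)))\<^sup>2 + t * r w)
        + (Q \<bullet> x0 - 1 / (2 * \<gamma>) * (norm Q)\<^sup>2)" for w
    proof -
      define h where "h = w - x0"
      have e: "w - (x0 - (1 / \<gamma>) *\<^sub>R Q) = h + (1 / \<gamma>) *\<^sub>R Q" by (simp add: h_def)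
      have "\<gamma> * (1 / 2 * ((h + (1 / \<gamma>) *\<^sub>R Q) \<bullet> (h + (1 / \<gamma>) *\<^sub>R Q)))
          = \<gamma> / 2 * (h \<bullet> h) + Q \<bullet> h + 1 / (2 * \<gamma>) * (Q \<bullet> Q)"
        using init(2) by (simp add: inner_add_left inner_add_right inner_commute[of h Q] field_simps)
      then have "\<gamma> * (1 / 2 * (norm (w - (x0 - (1 / \<gamma>) *\<^sub>R Q)))\<^sup>2)
          = \<gamma> / 2 * (norm (w - x0))\<^sup>2 + Q \<bullet> (w - x0) + 1 / (2 * \<gamma>) * (norm Q)\<^sup>2"
        by (simp only: e power2_norm_eq_inner h_def[symmetric])
      moreover have "\<phi> k w = Q \<bullet> w + \<gamma> / 2 * (norm (w - x0))\<^sup>2 + \<gamma> * (t * r w)"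
        using init q_eq[of n] Suc assms by (simp add: \<phi>_def Q_def t_def del: transpose_matrix_vector)
      ultimately show ?thesis
        by (simp add: inner_diff_right distrib_left add_divide_distrib diff_divide_distrib)
    qed
    have "\<phi> k (x k) + (\<gamma> + \<sigma> * s k) / 2 * (norm (u - x k))\<^sup>2 \<le> \<phi> k u" if u: "u \<in> X"
    proof -
      have e: "(\<gamma> + \<sigma> * s k) / 2 = \<gamma> * ((1 + \<sigma> * t) / 2)" using init by (simp add: t_def field_simps)
      show ?thesis
        unfolding f e using mult_left_mono[OF P(2)[OF u], of \<gamma>] init by (simp add: algebra_simps)
    qed
    then show ?thesis using P(1) by blast
  qed
  then show "x k \<in> X" "u \<in> X \<Longrightarrow> \<phi> k (x k) + (\<gamma> + \<sigma> * s k) / 2 * (norm (u - x k))\<^sup>2 \<le> \<phi> k u"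
    by blast+
qed

lemma dy_eq: "k \<in> {1..K} \<Longrightarrow> dy k = (\<gamma> * real m * a k) *\<^sub>R vec_block (S (j k)) (G k)"
  using y_step by (simp add: dy_def)

lemma dy_inner: "k \<in> {1..K} \<Longrightarrow> dy k \<bullet> v = dy k \<bullet> vec_block (S (j k)) v"
  by (simp add: dy_eq inner_vec_block vec_block_idem)

text \<open>Only the selected block of \<open>dy k\<close> is nonzero, so \<open>A\<close> acts through a single row block of norm at most
\<open>Lhat\<close>.  The step size satisfies \<open>(m * a k * Lhat)\<^sup>2 = (\<gamma> + \<sigma> * s (k - 1)) / (4 * \<gamma>)\<close>, which is
what Young's inequality needs to split the product with these two coefficients.\<close>

lemma coupling_bound:
  assumes k: "k \<le> K"
  shows "\<bar>D k \<bullet> (A *v h)\<bar> \<le> (\<gamma> + \<sigma> * s k) / 4 * (norm h)\<^sup>2 + 1 / (4 * \<gamma>) * (norm (dy k))\<^sup>2"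
proof (cases k)
  case 0
  then show ?thesis using init by simp
next
  case (Suc n)
  then have kK: "k \<in> {1..K}" using k by simp
  \<comment> \<open>The bound on the product is \<open>e * p * norm h\<close>, and \<open>(Q * norm h - 2 * e * p)\<^sup>2 \<ge> 0\<close> splits it.\<close>
  define e where "e = real m * a k * Lhat"
  define Q where "Q = \<gamma> + \<sigma> * s k"
  have s: "0 \<le> s n" "0 \<le> a k" "0 \<le> s k" using a_s_pos[of n] a_s_pos[of k] k Suc by auto
  have Q: "Q > 0" using s sigma init by (simp add: Q_def add_pos_nonneg)
  have e0: "e \<ge> 0" using s Lhat by (simp add: e_def)
  have "e = sqrt (1 + \<sigma> * s n / \<gamma>) / 2"
    using a_eq[of n] kK Suc Lhat m_pos by (simp add: e_def)
  then have "2 * e = sqrt (1 + \<sigma> * s n / \<gamma>)" by simp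
  then have "4 * e\<^sup>2 = (sqrt (1 + \<sigma> * s n / \<gamma>))\<^sup>2"
    by (metis four_x_squared)
  also have "\<dots> = 1 + \<sigma> * s n / \<gamma>" using s sigma init by (intro real_sqrt_pow2) simp
  also have "\<dots> = (\<gamma> + \<sigma> * s n) / \<gamma>" using init by (simp add: field_simps)
  also have "\<dots> \<le> Q / \<gamma>"
    unfolding Q_def using init sigma s Suc by (intro divide_right_mono) (auto simp: s_Suc algebra_simps)
  finally have e: "4 * e\<^sup>2 \<le> Q / \<gamma>" .
  define p where "p = norm (dy k)"
  have "\<bar>dy k \<bullet> (A *v h)\<bar> \<le> p * norm (vec_block (S (j k)) (A *v h))"
    unfolding dy_inner[OF kK, of "A *v h"] p_def by (rule Cauchy_Schwarz_ineq2)
  also have "\<dots> \<le> p * (Lhat * norm h)"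
    unfolding p_def using norm_block_mult_le[OF j_range[OF kK]] by (intro mult_left_mono) auto
  finally have "real m * a k * \<bar>dy k \<bullet> (A *v h)\<bar> \<le> real m * a k * (p * (Lhat * norm h))"
    using s by (intro mult_left_mono) auto
  then have 1: "\<bar>D k \<bullet> (A *v h)\<bar> \<le> e * p * norm h"
    using s by (simp add: D_def e_def abs_mult mult_ac)
  have "4 * Q * (e * p * norm h) \<le> Q\<^sup>2 * (norm h)\<^sup>2 + 4 * e\<^sup>2 * p\<^sup>2"
    using zero_le_power2[of "Q * norm h - 2 * e * p"] by (simp add: power2_eq_square algebra_simps)
  also have "\<dots> \<le> Q\<^sup>2 * (norm h)\<^sup>2 + Q / \<gamma> * p\<^sup>2"
    using e by (intro add_left_mono mult_right_mono) auto
  also have "\<dots> = 4 * Q * (Q / 4 * (norm h)\<^sup>2 + 1 / (4 * \<gamma>) * p\<^sup>2)"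
    using init by (simp add: field_simps power2_eq_square)
  finally have "e * p * norm h \<le> Q / 4 * (norm h)\<^sup>2 + 1 / (4 * \<gamma>) * p\<^sup>2" using Q by simp
  then show ?thesis using 1 unfolding Q_def p_def by linarith
qed

text \<open>The three-point identity of a gradient ascent step on the selected block.  Since \<open>dy\<close> is supported
on that block, \<open>dy \<bullet> G\<close> is \<open>(norm dy)\<^sup>2\<close> up to the step size, and replacing the scaled block of \<open>G\<close> by
\<open>G\<close> itself costs exactly the noise term.\<close>

lemma dual_step:
  assumes k: "Suc k \<le> K"
  shows "a (Suc k) * (v \<bullet> G (Suc k)) - (a (Suc k) *\<^sub>R y k + D (Suc k)) \<bullet> G (Suc k)
    = 1 / (2 * \<gamma>) * (norm (v - y k))\<^sup>2 - 1 / (2 * \<gamma>) * (norm (v - y (Suc k)))\<^sup>2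
      - 1 / (2 * \<gamma>) * (norm (dy (Suc k)))\<^sup>2 + (v - y k) \<bullet> noise (Suc k)"
proof -
  have kK: "Suc k \<in> {1..K}" using k by simp
  define e where "e = v - y k"
  define d where "d = dy (Suc k)"
  define g where "g = G (Suc k)"
  define pg where "pg = vec_block (S (j (Suc k))) g"
  define \<alpha> where "\<alpha> = real m * a (Suc k)"
  have d: "d = (\<gamma> * \<alpha>) *\<^sub>R pg" unfolding d_def pg_def g_def \<alpha>_def using dy_eq[OF kK] by (simp add: mult_ac)
  have dd: "d \<bullet> d = \<gamma> * \<alpha> * (d \<bullet> g)"
    using dy_inner[OF kK, of g] by (subst (2) d) (simp add: d_def pg_def)
  have "v - y (Suc k) = e - d" by (simp add: e_def d_def dy_def)
  then have E: "(norm (v - y (Suc k)))\<^sup>2 = (norm e)\<^sup>2 - 2 * (e \<bullet> d) + d \<bullet> d"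
    by (simp add: power2_norm_eq_inner inner_diff_left inner_diff_right inner_commute)
  have "1 / (2 * \<gamma>) * (norm e)\<^sup>2 - 1 / (2 * \<gamma>) * (norm (v - y (Suc k)))\<^sup>2
      - 1 / (2 * \<gamma>) * (norm d)\<^sup>2 = 1 / \<gamma> * (e \<bullet> d) - 1 / \<gamma> * (d \<bullet> d)"
    unfolding E using init by (simp add: power2_norm_eq_inner field_simps)
  also have "\<dots> = \<alpha> * (e \<bullet> pg) - \<alpha> * (d \<bullet> g)"
    unfolding dd using init by (subst d) simp
  finally have 1: "1 / (2 * \<gamma>) * (norm e)\<^sup>2 - 1 / (2 * \<gamma>) * (norm (v - y (Suc k)))\<^sup>2
      - 1 / (2 * \<gamma>) * (norm d)\<^sup>2 = \<alpha> * (e \<bullet> pg) - \<alpha> * (d \<bullet> g)" .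
  have 2: "e \<bullet> noise (Suc k) = a (Suc k) * (e \<bullet> g) - \<alpha> * (e \<bullet> pg)"
    by (simp add: noise_def g_def pg_def \<alpha>_def inner_diff_right algebra_simps)
  have "a (Suc k) * (v \<bullet> g) - (a (Suc k) *\<^sub>R y k + D (Suc k)) \<bullet> g
      = a (Suc k) * (e \<bullet> g) - \<alpha> * (d \<bullet> g)"
    by (simp add: e_def D_def d_def \<alpha>_def inner_diff_left inner_add_left algebra_simps)
  then show ?thesis using 1 2 unfolding e_def d_def g_def by linarith
qed

lemma \<phi>_Suc: "\<phi> (Suc k) u
    = \<phi> k u + a (Suc k) * (c \<bullet> u + r u) + (a (Suc k) *\<^sub>R y k + D k) \<bullet> (A *v u)"
  unfolding \<phi>_def inner_add_left inner_transpose_mult inner_scaleR_left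
  by (simp add: s_Suc Y_Suc inner_add_left inner_diff_left algebra_simps)

text \<open>By convexity of \<open>r\<close>, an upper bound on \<open>s k\<close> times the Lagrangian at the averaged primal point and \<open>v\<close>.\<close>

definition U :: "nat \<Rightarrow> real^'n \<Rightarrow> real" where
  "U k v = (\<Sum>i=1..k. a i * (c \<bullet> x i + r (x i) + v \<bullet> G i))"

text \<open>The estimate-sequence induction.  In each step the growth of \<open>\<phi> k\<close> around \<open>x k\<close> pays for the change of the
primal iterate, and the dual step produces a telescoping distance to \<open>v\<close>.  What remains is
\<open>D k \<bullet> (A *v (x (k + 1) - x k))\<close>, which \<open>coupling_bound\<close> absorbs; it consumes
\<open>1 / (4 * \<gamma>) * (norm (dy k))\<^sup>2\<close>, so this amount is kept in reserve for the latest \<open>k\<close> as an additional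
summand on the left.\<close>

lemma estimate_sequence:
  "k \<le> K \<Longrightarrow> U k v + 1 / (2 * \<gamma>) * (norm (v - y k))\<^sup>2
      + 1 / (4 * \<gamma>) * (\<Sum>i=1..k. (norm (dy i))\<^sup>2) + 1 / (4 * \<gamma>) * (norm (dy k))\<^sup>2
    \<le> \<phi> k (x k) + D k \<bullet> (A *v x k) - Y k \<bullet> b + 1 / (2 * \<gamma>) * (norm (v - y0))\<^sup>2
      + (\<Sum>i=1..k. (v - y (i - 1)) \<bullet> noise i)"
proof (induction k)
  case 0
  then show ?case using start by (simp add: \<phi>_def U_def)
next
  case (Suc k)
  define n where "n = Suc k"
  have U: "U n v = U k v + a n * (c \<bullet> x n + r (x n)) + a n * (v \<bullet> G n)"
    by (simp add: U_def n_def algebra_simps)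
  have min: "\<phi> k (x k) + (\<gamma> + \<sigma> * s k) / 2 * (norm (x n - x k))\<^sup>2 \<le> \<phi> k (x n)"
    using \<phi>_min[of k "x n"] x_in_X[of n] Suc by (simp add: n_def)
  have coup: "- (D k \<bullet> (A *v (x n - x k)))
      \<le> (\<gamma> + \<sigma> * s k) / 4 * (norm (x n - x k))\<^sup>2 + 1 / (4 * \<gamma>) * (norm (dy k))\<^sup>2"
    using coupling_bound[of k "x n - x k"] Suc by linarith
  have "0 \<le> (\<gamma> + \<sigma> * s k) / 4 * (norm (x n - x k))\<^sup>2"
    using a_s_pos[of k] Suc init sigma by simp
  then have half: "(\<gamma> + \<sigma> * s k) / 4 * (norm (x n - x k))\<^sup>2
      \<le> (\<gamma> + \<sigma> * s k) / 2 * (norm (x n - x k))\<^sup>2" by simp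
  have lin: "D k \<bullet> (A *v (x n - x k)) = D k \<bullet> (A *v x n) - D k \<bullet> (A *v x k)"
    by (simp add: matrix_vector_mult_diff_distrib inner_diff_right)
  have Yb: "Y n \<bullet> b = Y k \<bullet> b + (a n *\<^sub>R y k + D n) \<bullet> b"
    by (simp add: n_def Y_Suc inner_add_left)
  have gn: "(a n *\<^sub>R y k + D n) \<bullet> G n
      = (a n *\<^sub>R y k + D k) \<bullet> (A *v x n) - D k \<bullet> (A *v x n) + D n \<bullet> (A *v x n)
        - (a n *\<^sub>R y k + D n) \<bullet> b"
    by (simp add: G_def inner_diff_right inner_add_left)
  have sq: "1 / (4 * \<gamma>) * (\<Sum>i=1..n. (norm (dy i))\<^sup>2)
      = 1 / (4 * \<gamma>) * (\<Sum>i=1..k. (norm (dy i))\<^sup>2) + 1 / (4 * \<gamma>) * (norm (dy n))\<^sup>2"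
    "1 / (2 * \<gamma>) * (norm (dy n))\<^sup>2 = 1 / (4 * \<gamma>) * (norm (dy n))\<^sup>2 + 1 / (4 * \<gamma>) * (norm (dy n))\<^sup>2"
    using init by (simp_all add: n_def field_simps)
  have ns: "(\<Sum>i=1..n. (v - y (i - 1)) \<bullet> noise i)
      = (\<Sum>i=1..k. (v - y (i - 1)) \<bullet> noise i) + (v - y k) \<bullet> noise n"
    by (simp add: n_def)
  note ih = Suc.IH[OF Suc_leD[OF Suc.prems]]
  note d = dual_step[OF Suc.prems, of v, folded n_def]
  note p = \<phi>_Suc[of k "x n", folded n_def]
  show ?case
    unfolding n_def[symmetric]
    using ih d p min coup half lin Yb gn sq ns U by linarith
qed

lemma avg_in_X:
  assumes k: "k \<in> {1..K}"
  shows "(1 / s k) *\<^sub>R (\<Sum>i=1..k. a i *\<^sub>R x i) \<in> X"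
    and "s k * r ((1 / s k) *\<^sub>R (\<Sum>i=1..k. a i *\<^sub>R x i)) \<le> (\<Sum>i=1..k. a i * r (x i))"
proof -
  have sk: "s k > 0" using a_s_pos[of k] k by simp
  have e: "(1 / s k) *\<^sub>R (\<Sum>i=1..k. a i *\<^sub>R x i) = (\<Sum>i=1..k. (a i / s k) *\<^sub>R x i)"
    by (simp add: scaleR_sum_right)
  have w: "(\<Sum>i=1..k. a i / s k) = 1" using sk by (simp add: sum_divide_distrib[symmetric] s_def)
  have w0: "0 \<le> a i / s k" if "i \<in> {1..k}" for i using a_s_pos[of i] sk k that by simp
  show "(1 / s k) *\<^sub>R (\<Sum>i=1..k. a i *\<^sub>R x i) \<in> X"
    unfolding e using X w w0 x_in_X k by (intro convex_sum) auto
  have "r (\<Sum>i=1..k. (a i / s k) *\<^sub>R x i) \<le> (\<Sum>i=1..k. (a i / s k) * r (x i))"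
    using k w w0 by (intro convex_on_sum[OF _ _ r]) auto
  also have "\<dots> = (\<Sum>i=1..k. a i * r (x i)) / s k" by (simp add: sum_divide_distrib)
  finally show "s k * r ((1 / s k) *\<^sub>R (\<Sum>i=1..k. a i *\<^sub>R x i)) \<le> (\<Sum>i=1..k. a i * r (x i))"
    unfolding e using sk by (simp add: field_simps)
qed

text \<open>The reserved term of \<open>estimate_sequence\<close> and half of the growth of \<open>\<phi> k\<close> between \<open>u\<close> and \<open>x k\<close> pay for
the last coupling term \<open>D k \<bullet> (A *v (x k - u))\<close>; the other half survives as the bound on the primal distance.
The sum of squared dual steps is retained because it will dominate the variance of the noise.\<close>

lemma gap_bound:
  assumes k: "k \<in> {1..K}" and u: "u \<in> X"
  defines "xt \<equiv> (1 / s k) *\<^sub>R (\<Sum>i=1..k. a i *\<^sub>R x i)" and "yt \<equiv> (1 / s k) *\<^sub>R Y k"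
  shows "s k * (lagrangian c r A b xt v - lagrangian c r A b u yt)
      + (\<gamma> + \<sigma> * s k) / 4 * (norm (u - x k))\<^sup>2 + 1 / (2 * \<gamma>) * (norm (v - y k))\<^sup>2
      + 1 / (4 * \<gamma>) * (\<Sum>i=1..k. (norm (dy i))\<^sup>2)
    \<le> \<gamma> / 2 * (norm (u - x0))\<^sup>2 + 1 / (2 * \<gamma>) * (norm (v - y0))\<^sup>2
      + (\<Sum>i=1..k. (v - y (i - 1)) \<bullet> noise i)"
proof -
  have kK: "k \<le> K" using k by simp
  have sk: "s k > 0" using a_s_pos[of k] k by simp
  have xt: "s k *\<^sub>R xt = (\<Sum>i=1..k. a i *\<^sub>R x i)" and yt: "s k *\<^sub>R yt = Y k"
    using sk by (simp_all add: xt_def yt_def)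
  have h: "s k * (h \<bullet> xt) = (\<Sum>i=1..k. a i * (h \<bullet> x i))" for h
    using arg_cong[OF xt, of "\<lambda>w. h \<bullet> w"] by (simp add: inner_sum_right)
  have "s k * lagrangian c r A b xt v
      = s k * (c \<bullet> xt) + s k * r xt + s k * ((transpose A *v v) \<bullet> xt) - s k * (v \<bullet> b)"
    unfolding lagrangian_def inner_transpose_mult by (simp add: algebra_simps)
  also have "\<dots> \<le> (\<Sum>i=1..k. a i * (c \<bullet> x i)) + (\<Sum>i=1..k. a i * r (x i))
      + (\<Sum>i=1..k. a i * (v \<bullet> (A *v x i))) - s k * (v \<bullet> b)"
    using avg_in_X(2)[OF k, folded xt_def] unfolding h unfolding inner_transpose_mult by simp
  also have "\<dots> = U k v"
    unfolding U_def s_def G_def sum_distrib_right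
    by (simp add: sum.distrib[symmetric] sum_subtractf[symmetric] inner_diff_right algebra_simps)
  finally have 1: "s k * lagrangian c r A b xt v \<le> U k v" .
  have yt': "s k * (yt \<bullet> w) = Y k \<bullet> w" for w using arg_cong[OF yt, of "\<lambda>v. v \<bullet> w"] by simp
  have "s k * lagrangian c r A b u yt
      = s k * (c \<bullet> u) + s k * r u + s k * (yt \<bullet> (A *v u)) - s k * (yt \<bullet> b)"
    unfolding lagrangian_def by (simp add: algebra_simps)
  also have "\<dots> = \<phi> k u + D k \<bullet> (A *v u) - \<gamma> / 2 * (norm (u - x0))\<^sup>2 - Y k \<bullet> b"
    unfolding \<phi>_def inner_add_left inner_transpose_mult yt' by (simp add: inner_diff_left)
  finally have 2: "s k * lagrangian c r A b u yt
    = \<phi> k u + D k \<bullet> (A *v u) - \<gamma> / 2 * (norm (u - x0))\<^sup>2 - Y k \<bullet> b" .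
  have 3: "D k \<bullet> (A *v (x k - u)) \<le> (\<gamma> + \<sigma> * s k) / 4 * (norm (u - x k))\<^sup>2 + 1 / (4 * \<gamma>) * (norm (dy k))\<^sup>2"
    using coupling_bound[OF kK, of "x k - u"] unfolding norm_minus_commute[of u "x k"] by linarith
  have 4: "D k \<bullet> (A *v (x k - u)) = D k \<bullet> (A *v x k) - D k \<bullet> (A *v u)"
    by (simp add: matrix_vector_mult_diff_distrib inner_diff_right)
  have 5: "s k * (lagrangian c r A b xt v - lagrangian c r A b u yt)
    = s k * lagrangian c r A b xt v - s k * lagrangian c r A b u yt" by (rule right_diff_distrib)
  have 6: "(\<gamma> + \<sigma> * s k) / 2 * (norm (u - x k))\<^sup>2
    = (\<gamma> + \<sigma> * s k) / 4 * (norm (u - x k))\<^sup>2 + (\<gamma> + \<sigma> * s k) / 4 * (norm (u - x k))\<^sup>2" by simp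
  show ?thesis using 1 2 3 4 5 6 estimate_sequence[OF kK, of v] \<phi>_min[OF kK u] by linarith
qed

end

section \<open>Dependence of the iterates on the draws\<close>

text \<open>The draw with index \<open>k\<close> is made after \<open>x k\<close> is computed; hence \<open>x (k + 1)\<close> depends on the first \<open>k\<close> draws
only.  This makes the noise terms martingale differences.\<close>

lemma (in clvr_problem) runs_agree:
  assumes "clvr_path X c r A b x0 y0 \<gamma> Lhat \<sigma> K m S j a Asc x y z q"
    and "clvr_path X c r A b x0 y0 \<gamma> Lhat \<sigma> K m S j' a Asc x' y' z' q'"
    and "k \<le> K" and "\<And>i. i \<in> {1..k} \<Longrightarrow> j i = j' i"
  shows "x k = x' k \<and> y k = y' k \<and> z k = z' k \<and> q k = q' k"
    and "k < K \<Longrightarrow> x (Suc k) = x' (Suc k)"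
proof -
  interpret P: clvr_path X c r A b x0 y0 \<gamma> Lhat \<sigma> K m S j a Asc x y z q by fact
  interpret P': clvr_path X c r A b x0 y0 \<gamma> Lhat \<sigma> K m S j' a Asc x' y' z' q' by fact
  show *: "x k = x' k \<and> y k = y' k \<and> z k = z' k \<and> q k = q' k"
    using assms(3,4)
  proof (induction k)
    case 0
    show ?case using P.start P'.start by simp
  next
    case (Suc k)
    then have IH: "x k = x' k" "y k = y' k" "z k = z' k" "q k = q' k" by simp_all
    have k: "Suc k \<in> {1..K}" using Suc.prems by simp
    have jk: "j (Suc k) = j' (Suc k)" using Suc.prems by simp
    have x: "x (Suc k) = x' (Suc k)"
      unfolding P.x_step[OF k] P'.x_step[OF k] by (simp only: diff_Suc_1 IH)
    then have y: "y (Suc k) = y' (Suc k)"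
      unfolding P.y_step[OF k] P'.y_step[OF k] P.G_def P'.G_def by (simp only: diff_Suc_1 IH jk)
    then have z: "z (Suc k) = z' (Suc k)"
      unfolding P.z_step[OF k] P'.z_step[OF k] P.dy_def P'.dy_def by (simp only: diff_Suc_1 IH)
    then have "q (Suc k) = q' (Suc k)"
      unfolding P.q_step[OF k] P'.q_step[OF k] by (simp only: diff_Suc_1 IH)
    with x y z show ?case by blast
  qed
  show "x (Suc k) = x' (Suc k)" if "k < K"
  proof -
    have k: "Suc k \<in> {1..K}" using that by simp
    show ?thesis
      unfolding P.x_step[OF k] P'.x_step[OF k] by (simp only: diff_Suc_1 *)
  qed
qed

section \<open>Averaging over independent uniform draws\<close>

locale uniform_draws = prob_space M for M :: "'w measure" +
  fixes j :: "nat \<Rightarrow> 'w \<Rightarrow> nat" and K m :: nat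
  assumes indep: "indep_vars (\<lambda>_. count_space {1..m}) j {1..K}"
    and unif: "\<And>k. k \<in> {1..K} \<Longrightarrow>
      distr M (count_space {1..m}) (j k) = uniform_count_measure {1..m}"
begin

text \<open>Measurability with respect to the first \<open>k\<close> draws.  As these take finitely many values, no
sigma-algebra is needed: it suffices that equal draws give equal values.\<close>

definition determined :: "nat \<Rightarrow> ('w \<Rightarrow> 'b) \<Rightarrow> bool" where
  "determined k F \<longleftrightarrow> (\<forall>\<omega>\<in>space M. \<forall>\<omega>'\<in>space M.
     (\<forall>i\<in>{1..k}. j i \<omega> = j i \<omega>') \<longrightarrow> F \<omega> = F \<omega>')"

lemma determinedD:
  "determined k F \<Longrightarrow> \<omega> \<in> space M \<Longrightarrow> \<omega>' \<in> space M \<Longrightarrow> (\<And>i. i \<in> {1..k} \<Longrightarrow> j i \<omega> = j i \<omega>')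
    \<Longrightarrow> F \<omega> = F \<omega>'"
  unfolding determined_def by blast

lemma determined_mono: "determined k F \<Longrightarrow> k \<le> l \<Longrightarrow> determined l F"
  unfolding determined_def by (meson atLeastAtMost_iff order_trans)

lemma determined_draw: "i \<in> {1..k} \<Longrightarrow> determined k (j i)"
  by (auto simp: determined_def)

lemma determined_map: "determined k F \<Longrightarrow> determined k (\<lambda>\<omega>. h (F \<omega>))"
  unfolding determined_def by metis

lemma determined_map2: "determined k F \<Longrightarrow> determined k H \<Longrightarrow> determined k (\<lambda>\<omega>. h (F \<omega>) (H \<omega>))"
  unfolding determined_def by metis

lemma determined_sum:
  assumes "\<And>i. i \<in> I \<Longrightarrow> determined k (F i)"
  shows "determined k (\<lambda>\<omega>. \<Sum>i\<in>I. F i \<omega>)"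
  unfolding determined_def
proof (intro ballI impI sum.cong refl)
  fix \<omega> \<omega>' i
  assume "\<omega> \<in> space M" "\<omega>' \<in> space M" "\<forall>i\<in>{1..k}. j i \<omega> = j i \<omega>'" "i \<in> I"
  then show "F i \<omega> = F i \<omega>'" using determinedD[OF assms[of i], of \<omega> \<omega>'] by blast
qed

definition history :: "nat \<Rightarrow> 'w \<Rightarrow> nat \<Rightarrow> nat" where
  "history k \<omega> = restrict (\<lambda>i. j i \<omega>) {1..k}"

lemma draw_measurable: "i \<in> {1..K} \<Longrightarrow> j i \<in> measurable M (count_space {1..m})"
  using indep by (auto simp: indep_vars_def)

lemma draw_range: "i \<in> {1..K} \<Longrightarrow> \<omega> \<in> space M \<Longrightarrow> j i \<omega> \<in> {1..m}"
  using measurable_space[OF draw_measurable, of i \<omega>] by simp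

lemma product_space: "PiM {1..k::nat} (\<lambda>_. count_space {1..m}) = count_space ({1..k} \<rightarrow>\<^sub>E {1..m::nat})"
  by (rule count_space_PiM_finite) auto

lemma history_measurable:
  "k \<le> K \<Longrightarrow> history k \<in> measurable M (count_space ({1..k} \<rightarrow>\<^sub>E {1..m}))"
  unfolding product_space[symmetric] history_def
  by (rule measurable_restrict, rule draw_measurable) simp

lemma determined_factor:
  assumes "determined k F"
  obtains f where "\<And>\<omega>. \<omega> \<in> space M \<Longrightarrow> F \<omega> = f (history k \<omega>)"
proof
  fix \<omega> assume w: "\<omega> \<in> space M"
  define \<omega>' where "\<omega>' = (SOME \<omega>'. \<omega>' \<in> space M \<and> history k \<omega>' = history k \<omega>)"
  have "\<omega>' \<in> space M \<and> history k \<omega>' = history k \<omega>"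
    unfolding \<omega>'_def by (rule someI[of _ \<omega>]) (simp add: w)
  then have w': "\<omega>' \<in> space M" "history k \<omega>' = history k \<omega>" by auto
  have "j i \<omega>' = j i \<omega>" if "i \<in> {1..k}" for i
    using fun_cong[OF w'(2), of i] that by (simp add: history_def)
  then have "F \<omega> = F \<omega>'" using determinedD[OF assms w'(1) w] by simp
  then show "F \<omega> = (\<lambda>p. F (SOME \<omega>'. \<omega>' \<in> space M \<and> history k \<omega>' = p)) (history k \<omega>)"
    by (simp add: \<omega>'_def)
qed

lemma determined_integrable:
  fixes F :: "'w \<Rightarrow> real"
  assumes F: "determined k F" and k: "k \<le> K"
  shows "integrable M F"
proof -
  obtain f where f: "\<And>\<omega>. \<omega> \<in> space M \<Longrightarrow> F \<omega> = f (history k \<omega>)"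
    using determined_factor[OF F] by blast
  have "(\<lambda>\<omega>. f (history k \<omega>)) \<in> borel_measurable M"
    using measurable_compose[OF history_measurable[OF k], of f borel] by simp
  then have meas: "F \<in> borel_measurable M" using f by (simp cong: measurable_cong)
  have "finite (f ` ({1..k} \<rightarrow>\<^sub>E {1..m}))" by (intro finite_imageI finite_PiE) auto
  then obtain B where B: "\<And>v. v \<in> f ` ({1..k} \<rightarrow>\<^sub>E {1..m}) \<Longrightarrow> norm v \<le> B"
    using finite_imp_bounded bounded_iff by metis
  have "norm (F \<omega>) \<le> B" if w: "\<omega> \<in> space M" for \<omega>
    using B[of "F \<omega>"] f[OF w] measurable_space[OF history_measurable[OF k] w] by simp
  then show ?thesis using meas by (intro integrable_const_bound[of _ B]) auto
qed

lemma prob_draw: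
  assumes k: "k \<in> {1..K}" and i: "i \<in> {1..m}"
  shows "expectation (\<lambda>\<omega>. indicator {i} (j k \<omega>)) = 1 / real m"
proof -
  have "expectation (\<lambda>\<omega>. indicator {i} (j k \<omega>))
      = integral\<^sup>L (distr M (count_space {1..m}) (j k)) (indicator {i} :: nat \<Rightarrow> real)"
    by (subst integral_distr[OF draw_measurable[OF k]]) auto
  also have "\<dots> = measure (uniform_count_measure {1..m}) {i}"
    unfolding unif[OF k] using i by simp
  also have "\<dots> = 1 / real m" using i by (subst measure_uniform_count_measure) auto
  finally show ?thesis .
qed

text \<open>Conditioning on the first \<open>k\<close> draws averages over the next one, as it is uniform and independent of
them.\<close>

lemma average_over_next_draw:
  fixes H :: "'w \<Rightarrow> nat \<Rightarrow> real"
  assumes H: "\<And>i. i \<in> {1..m} \<Longrightarrow> determined k (\<lambda>\<omega>. H \<omega> i)" and k: "Suc k \<le> K"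
  shows "expectation (\<lambda>\<omega>. H \<omega> (j (Suc k) \<omega>)) = expectation (\<lambda>\<omega>. (\<Sum>i=1..m. H \<omega> i) / real m)"
proof -
  have kK: "Suc k \<in> {1..K}" using k by simp
  have each: "integrable M (\<lambda>\<omega>. H \<omega> i * indicator {i} (j (Suc k) \<omega>)) \<and>
      expectation (\<lambda>\<omega>. H \<omega> i * indicator {i} (j (Suc k) \<omega>)) = expectation (\<lambda>\<omega>. H \<omega> i) / real m"
    if i: "i \<in> {1..m}" for i
  proof -
    obtain f where f: "\<And>\<omega>. \<omega> \<in> space M \<Longrightarrow> H \<omega> i = f (history k \<omega>)"
      using determined_factor[OF H[OF i]] by blast
    define ind :: "(nat \<Rightarrow> nat) \<Rightarrow> real" where "ind p = indicator {i} (p (Suc k))" for p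
    have "indep_var (count_space ({1..k} \<rightarrow>\<^sub>E {1..m})) (history k)
        (PiM {Suc k} (\<lambda>_. count_space {1..m})) (\<lambda>\<omega>. restrict (\<lambda>i. j i \<omega>) {Suc k})"
      using indep_var_restrict[OF indep, of "{1..k}" "{Suc k}"] k
      unfolding product_space history_def[abs_def] by simp
    moreover have "ind \<in> borel_measurable (PiM {Suc k} (\<lambda>_. count_space {1..m}))"
      unfolding ind_def
      by (rule measurable_compose[OF measurable_component_singleton]) auto
    ultimately have ind: "indep_var borel (f \<circ> history k) borel (ind \<circ> (\<lambda>\<omega>. restrict (\<lambda>i. j i \<omega>) {Suc k}))"
      by (intro indep_var_compose) auto
    have e: "(ind \<circ> (\<lambda>\<omega>. restrict (\<lambda>i. j i \<omega>) {Suc k})) = (\<lambda>\<omega>. indicator {i} (j (Suc k) \<omega>))"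
      by (simp add: fun_eq_iff ind_def)
    have i1: "integrable M (f \<circ> history k)"
    proof (rule Bochner_Integration.integrable_cong[THEN iffD1, OF refl])
      show "integrable M (\<lambda>\<omega>. H \<omega> i)" using determined_integrable[OF H[OF i]] k by simp
    qed (simp add: f)
    have i2: "integrable M (\<lambda>\<omega>. indicator {i} (j (Suc k) \<omega>) :: real)"
      using k by (intro determined_integrable[of "Suc k"]
          determined_map[OF determined_draw, of _ _ "indicator {i}"]) auto
    have "expectation (\<lambda>\<omega>. (f \<circ> history k) \<omega> * indicator {i} (j (Suc k) \<omega>))
        = expectation (f \<circ> history k) * expectation (\<lambda>\<omega>. indicator {i} (j (Suc k) \<omega>))"
      using indep_var_lebesgue_integral[OF ind i1] i2 unfolding e by (simp add: comp_def)
    moreover have "expectation (f \<circ> history k) = expectation (\<lambda>\<omega>. H \<omega> i)"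
      using f by (intro Bochner_Integration.integral_cong) auto
    moreover have "expectation (\<lambda>\<omega>. (f \<circ> history k) \<omega> * indicator {i} (j (Suc k) \<omega>))
        = expectation (\<lambda>\<omega>. H \<omega> i * indicator {i} (j (Suc k) \<omega>))"
      using f by (intro Bochner_Integration.integral_cong) auto
    moreover have "integrable M (\<lambda>\<omega>. H \<omega> i * indicator {i} (j (Suc k) \<omega>))"
      using k by (intro determined_integrable[of "Suc k"]
          determined_map2[OF determined_mono[OF H[OF i]] determined_draw,
            of "Suc k" _ "\<lambda>h l. h * indicator {i} l"]) auto
    ultimately show ?thesis using prob_draw[OF kK i] by simp
  qed
  have "expectation (\<lambda>\<omega>. H \<omega> (j (Suc k) \<omega>))
      = expectation (\<lambda>\<omega>. \<Sum>i=1..m. H \<omega> i * indicator {i} (j (Suc k) \<omega>))"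
  proof (rule Bochner_Integration.integral_cong[OF refl])
    fix \<omega> assume w: "\<omega> \<in> space M"
    have "(\<Sum>i=1..m. H \<omega> i * indicator {i} (j (Suc k) \<omega>))
        = (\<Sum>i\<in>{1..m}. if j (Suc k) \<omega> = i then H \<omega> i else 0)"
      by (intro sum.cong) auto
    also have "\<dots> = H \<omega> (j (Suc k) \<omega>)" using draw_range[OF kK w] by simp
    finally show "H \<omega> (j (Suc k) \<omega>) = (\<Sum>i=1..m. H \<omega> i * indicator {i} (j (Suc k) \<omega>))" by simp
  qed
  also have "\<dots> = (\<Sum>i=1..m. expectation (\<lambda>\<omega>. H \<omega> i) / real m)"
    using each by (subst Bochner_Integration.integral_sum) auto
  also have "\<dots> = expectation (\<lambda>\<omega>. (\<Sum>i=1..m. H \<omega> i) / real m)"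
    using k determined_integrable[OF H]
    by (simp add: sum_divide_distrib[symmetric] Bochner_Integration.integral_sum)
  finally show ?thesis .
qed

end

section \<open>The noise of the random process\<close>

locale clvr_process = clvr_problem X c r A b x0 y0 \<gamma> Lhat \<sigma> K m S + uniform_draws M j K m
  for X :: "(real^'d) set" and c :: "real^'d" and r :: "real^'d \<Rightarrow> real"
    and A :: "real^'d^'n" and b :: "real^'n"
    and x0 :: "real^'d" and y0 :: "real^'n"
    and \<gamma> Lhat \<sigma> :: real and K m :: nat and S :: "nat \<Rightarrow> 'n set"
    and M :: "'w measure" and j :: "nat \<Rightarrow> 'w \<Rightarrow> nat" +
  fixes a Asc :: "nat \<Rightarrow> real"
    and x z q :: "nat \<Rightarrow> 'w \<Rightarrow> real^'d" and y :: "nat \<Rightarrow> 'w \<Rightarrow> real^'n"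
  assumes clvr: "\<And>\<omega>. \<omega> \<in> space M \<Longrightarrow>
      clvr_run X c r A b x0 y0 \<gamma> Lhat \<sigma> K m S (\<lambda>k. j k \<omega>) a Asc
        (\<lambda>k. x k \<omega>) (\<lambda>k. y k \<omega>) (\<lambda>k. z k \<omega>) (\<lambda>k. q k \<omega>)"
begin

definition g :: "nat \<Rightarrow> 'w \<Rightarrow> real^'n" where "g k \<omega> = A *v x k \<omega> - b"

text \<open>The noise of \<^locale>\<open>clvr_path\<close> as a random variable.\<close>

definition N :: "nat \<Rightarrow> 'w \<Rightarrow> real^'n" where
  "N k \<omega> = a k *\<^sub>R (g k \<omega> - real m *\<^sub>R vec_block (S (j k \<omega>)) (g k \<omega>))"

definition sq_step :: "nat \<Rightarrow> 'w \<Rightarrow> real" where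
  "sq_step k \<omega> = (norm (y k \<omega> - y (k - 1) \<omega>))\<^sup>2"

lemma path:
  assumes "\<omega> \<in> space M"
  shows "clvr_path X c r A b x0 y0 \<gamma> Lhat \<sigma> K m S (\<lambda>k. j k \<omega>) a Asc
        (\<lambda>k. x k \<omega>) (\<lambda>k. y k \<omega>) (\<lambda>k. z k \<omega>) (\<lambda>k. q k \<omega>)"
  using clvr[OF assms] draw_range[OF _ assms] by unfold_locales auto

lemma Asc_1: "Asc 1 = 1 / (2 * Lhat * real m)"
  using clvr not_empty by (auto simp: clvr_run_def)

lemma scalars:
  assumes k: "k \<in> {1..K}"
  shows Asc_pos: "Asc k > 0"
    and Asc_Suc: "Asc (k + 1) = Asc k + sqrt (1 + \<sigma> / \<gamma> * Asc k) / (2 * Lhat * real m)"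
proof -
  obtain \<omega> where w: "\<omega> \<in> space M" using not_empty by blast
  interpret clvr_path X c r A b x0 y0 \<gamma> Lhat \<sigma> K m S "\<lambda>k. j k \<omega>" a Asc
    "\<lambda>k. x k \<omega>" "\<lambda>k. y k \<omega>" "\<lambda>k. z k \<omega>" "\<lambda>k. q k \<omega>" by (rule path[OF w])
  show "Asc k > 0" using Asc_eq[OF k] a_s_pos[of k] k by simp
  show "Asc (k + 1) = Asc k + sqrt (1 + \<sigma> / \<gamma> * Asc k) / (2 * Lhat * real m)"
    using Asc_step[OF k] a_step[OF k] by simp
qed

lemma determined_y:
  assumes "k \<le> K" shows "determined k (y k)"
  unfolding determined_def
proof (intro ballI impI)
  fix \<omega> \<omega>' assume w: "\<omega> \<in> space M" "\<omega>' \<in> space M" and "\<forall>i\<in>{1..k}. j i \<omega> = j i \<omega>'"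
  then have e: "\<And>i. i \<in> {1..k} \<Longrightarrow> j i \<omega> = j i \<omega>'" by blast
  show "y k \<omega> = y k \<omega>'"
    using runs_agree(1)[OF path[OF w(1)] path[OF w(2)] assms e] by simp
qed

lemma determined_x:
  assumes "k < K" shows "determined k (x (Suc k))"
  unfolding determined_def
proof (intro ballI impI)
  fix \<omega> \<omega>' assume w: "\<omega> \<in> space M" "\<omega>' \<in> space M" and "\<forall>i\<in>{1..k}. j i \<omega> = j i \<omega>'"
  then have e: "\<And>i. i \<in> {1..k} \<Longrightarrow> j i \<omega> = j i \<omega>'" by blast
  show "x (Suc k) \<omega> = x (Suc k) \<omega>'"
    using runs_agree(2)[OF path[OF w(1)] path[OF w(2)] less_imp_le[OF assms] e assms] .
qed

lemma determined_g: "k < K \<Longrightarrow> determined k (g (Suc k))"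
  unfolding g_def by (intro determined_map[of _ _ "\<lambda>u. A *v u - b"] determined_x)

lemma determined_N:
  assumes "k \<in> {1..K}" shows "determined k (N k)"
proof -
  have "k - 1 < K" "Suc (k - 1) = k" using assms by auto
  then have "determined (k - 1) (g k)" using determined_g[of "k - 1"] by simp
  then have "determined k (g k)" by (rule determined_mono) simp
  then show ?thesis
    unfolding N_def using assms
    by (intro determined_map2[of _ _ _ "\<lambda>u i. a k *\<^sub>R (u - real m *\<^sub>R vec_block (S i) u)"] determined_draw) auto
qed

lemma determined_sq_step: "k \<le> K \<Longrightarrow> determined k (sq_step k)"
  unfolding sq_step_def using determined_mono[OF determined_y[of "k - 1"], of k]
  by (intro determined_map2[of _ _ _ "\<lambda>u v. (norm (u - v))\<^sup>2"] determined_y) auto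

text \<open>The blocks add up to the full residual, so the noise has conditional mean zero.\<close>

lemma noise_orthogonal:
  assumes F: "determined k F" and k: "k < K"
  shows "expectation (\<lambda>\<omega>. F \<omega> \<bullet> N (Suc k) \<omega>) = 0"
proof -
  \<comment> \<open>The value of the inner product when block \<open>i\<close> is drawn.\<close>
  define H where "H \<omega> i = F \<omega> \<bullet> (a (Suc k) *\<^sub>R (g (Suc k) \<omega> - real m *\<^sub>R vec_block (S i) (g (Suc k) \<omega>)))" for \<omega> i
  have sum0: "(\<Sum>i=1..m. H \<omega> i) = 0" for \<omega>
  proof -
    have "(\<Sum>i=1..m. H \<omega> i) = F \<omega> \<bullet> (a (Suc k) *\<^sub>R
        (\<Sum>i=1..m. g (Suc k) \<omega> - real m *\<^sub>R vec_block (S i) (g (Suc k) \<omega>)))"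
      by (simp only: H_def inner_sum_right scaleR_sum_right)
    also have "(\<Sum>i=1..m. g (Suc k) \<omega> - real m *\<^sub>R vec_block (S i) (g (Suc k) \<omega>)) = 0"
      by (simp only: sum_subtractf scaleR_sum_right[symmetric] sum_vec_block
          sum_constant_scaleR card_atLeastAtMost) simp
    finally show ?thesis by simp
  qed
  have "expectation (\<lambda>\<omega>. H \<omega> (j (Suc k) \<omega>)) = expectation (\<lambda>\<omega>. (\<Sum>i=1..m. H \<omega> i) / real m)"
  proof (rule average_over_next_draw)
    show "determined k (\<lambda>\<omega>. H \<omega> i)" for i
      unfolding H_def
      by (intro determined_map2[OF F determined_g[OF k], of
        "\<lambda>f u. f \<bullet> (a (Suc k) *\<^sub>R (u - real m *\<^sub>R vec_block (S i) u))"])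
  qed (use k in simp)
  also have "\<dots> = 0" unfolding sum0 by simp
  finally show ?thesis unfolding H_def N_def .
qed

text \<open>With \<open>\<rho>\<close> the squared norm of \<open>a (k + 1) *\<^sub>R g (k + 1)\<close>, the conditional second moment of the noise is
\<open>(m - 1) * \<rho>\<close> and that of the dual step is \<open>\<gamma>\<^sup>2 * m * \<rho>\<close>.\<close>

lemma noise_variance:
  assumes k: "k < K"
  shows "\<gamma>\<^sup>2 * expectation (\<lambda>\<omega>. (norm (N (Suc k) \<omega>))\<^sup>2) \<le> expectation (sq_step (Suc k))"
proof -
  \<comment> \<open>The difference of the two sides when block \<open>i\<close> is drawn.\<close>
  define H where "H \<omega> i = (norm ((\<gamma> * real m * a (Suc k)) *\<^sub>R vec_block (S i) (g (Suc k) \<omega>)))\<^sup>2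
    - \<gamma>\<^sup>2 * (norm (a (Suc k) *\<^sub>R (g (Suc k) \<omega> - real m *\<^sub>R vec_block (S i) (g (Suc k) \<omega>))))\<^sup>2" for \<omega> i
  have sumH: "(\<Sum>i=1..m. H \<omega> i) = \<gamma>\<^sup>2 * (a (Suc k))\<^sup>2 * real m * (norm (g (Suc k) \<omega>))\<^sup>2" for \<omega>
  proof -
    define u where "u = g (Suc k) \<omega>"
    have H: "H \<omega> i = \<gamma>\<^sup>2 * (a (Suc k))\<^sup>2 * (2 * real m * (norm (vec_block (S i) u))\<^sup>2 - (norm u)\<^sup>2)" for i
    proof -
      have E: "(norm (u - real m *\<^sub>R vec_block (S i) u))\<^sup>2
          = (norm u)\<^sup>2 - 2 * real m * (norm (vec_block (S i) u))\<^sup>2 + (real m)\<^sup>2 * (norm (vec_block (S i) u))\<^sup>2"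
        unfolding power2_norm_eq_inner
        by (simp add: inner_diff_left inner_diff_right inner_vec_block vec_block_idem
            power2_eq_square algebra_simps)
      show ?thesis
        unfolding H_def u_def[symmetric] norm_scaleR power_mult_distrib power2_abs E
        by (simp add: algebra_simps)
    qed
    show ?thesis
      unfolding H sum_distrib_left[symmetric] sum_subtractf sum_norm_vec_block u_def[symmetric]
      by simp
  qed
  have "expectation (\<lambda>\<omega>. H \<omega> (j (Suc k) \<omega>)) = expectation (\<lambda>\<omega>. (\<Sum>i=1..m. H \<omega> i) / real m)"
  proof (rule average_over_next_draw)
    show "determined k (\<lambda>\<omega>. H \<omega> i)" for i
      unfolding H_def
      by (rule determined_map[OF determined_g[OF k], of
        "\<lambda>u. (norm ((\<gamma> * real m * a (Suc k)) *\<^sub>R vec_block (S i) u))\<^sup>2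
           - \<gamma>\<^sup>2 * (norm (a (Suc k) *\<^sub>R (u - real m *\<^sub>R vec_block (S i) u)))\<^sup>2"])
  qed (use k in simp)
  also have "\<dots> \<ge> 0" unfolding sumH by (intro integral_nonneg_AE) simp
  finally have "0 \<le> expectation (\<lambda>\<omega>. H \<omega> (j (Suc k) \<omega>))" .
  also have "\<dots> = expectation (\<lambda>\<omega>. sq_step (Suc k) \<omega> - \<gamma>\<^sup>2 * (norm (N (Suc k) \<omega>))\<^sup>2)"
  proof (rule Bochner_Integration.integral_cong[OF refl])
    fix \<omega> assume w: "\<omega> \<in> space M"
    interpret clvr_path X c r A b x0 y0 \<gamma> Lhat \<sigma> K m S "\<lambda>k. j k \<omega>" a Asc
      "\<lambda>k. x k \<omega>" "\<lambda>k. y k \<omega>" "\<lambda>k. z k \<omega>" "\<lambda>k. q k \<omega>" by (rule path[OF w])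
    show "H \<omega> (j (Suc k) \<omega>) = sq_step (Suc k) \<omega> - \<gamma>\<^sup>2 * (norm (N (Suc k) \<omega>))\<^sup>2"
      using y_step[of "Suc k"] k by (simp add: H_def sq_step_def N_def g_def G_def)
  qed
  also have "\<dots> = expectation (sq_step (Suc k)) - \<gamma>\<^sup>2 * expectation (\<lambda>\<omega>. (norm (N (Suc k) \<omega>))\<^sup>2)"
    using k by (subst Bochner_Integration.integral_diff)
      (auto intro!: determined_integrable[of "Suc k"] determined_sq_step determined_N
        determined_map[of _ _ "\<lambda>u. (norm u)\<^sup>2"] integrable_mult_right)
  finally show ?thesis by simp
qed

text \<open>Martingale differences are orthogonal, so the variances of the noise terms add up.\<close>

lemma accumulated_noise_variance:
  "k \<le> K \<Longrightarrow> \<gamma>\<^sup>2 * expectation (\<lambda>\<omega>. (norm (\<Sum>i=1..k. N i \<omega>))\<^sup>2) \<le> (\<Sum>i=1..k. expectation (sq_step i))"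
proof (induction k)
  case (Suc k)
  define P where "P \<omega> = (\<Sum>i=1..k. N i \<omega>)" for \<omega>
  have dP: "determined k P"
    unfolding P_def using Suc.prems
    by (intro determined_sum determined_mono[OF determined_N]) auto
  have dP': "determined (Suc k) P" using determined_mono[OF dP] by simp
  have dN: "determined (Suc k) (N (Suc k))" using Suc.prems by (intro determined_N) simp
  have "expectation (\<lambda>\<omega>. (norm (\<Sum>i=1..Suc k. N i \<omega>))\<^sup>2)
      = expectation (\<lambda>\<omega>. (norm (P \<omega>))\<^sup>2 + 2 * (P \<omega> \<bullet> N (Suc k) \<omega>) + (norm (N (Suc k) \<omega>))\<^sup>2)"
    by (intro Bochner_Integration.integral_cong)
      (simp_all add: P_def power2_norm_eq_inner inner_add_left inner_add_right inner_commute)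
  also have "\<dots> = expectation (\<lambda>\<omega>. (norm (P \<omega>))\<^sup>2) + 2 * expectation (\<lambda>\<omega>. P \<omega> \<bullet> N (Suc k) \<omega>)
      + expectation (\<lambda>\<omega>. (norm (N (Suc k) \<omega>))\<^sup>2)"
  proof -
    have "integrable M (\<lambda>\<omega>. (norm (P \<omega>))\<^sup>2)" "integrable M (\<lambda>\<omega>. P \<omega> \<bullet> N (Suc k) \<omega>)"
      "integrable M (\<lambda>\<omega>. (norm (N (Suc k) \<omega>))\<^sup>2)"
      using Suc.prems
      by (auto intro!: determined_integrable[of "Suc k"] determined_map[OF dP', of "\<lambda>u. (norm u)\<^sup>2"]
        determined_map[OF dN, of "\<lambda>u. (norm u)\<^sup>2"] determined_map2[OF dP' dN, of "(\<bullet>)"])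
    then show ?thesis by simp
  qed
  also have "expectation (\<lambda>\<omega>. P \<omega> \<bullet> N (Suc k) \<omega>) = 0"
    using noise_orthogonal[OF dP] Suc.prems by simp
  finally have "\<gamma>\<^sup>2 * expectation (\<lambda>\<omega>. (norm (\<Sum>i=1..Suc k. N i \<omega>))\<^sup>2)
      = \<gamma>\<^sup>2 * expectation (\<lambda>\<omega>. (norm (P \<omega>))\<^sup>2) + \<gamma>\<^sup>2 * expectation (\<lambda>\<omega>. (norm (N (Suc k) \<omega>))\<^sup>2)"
    by (simp add: distrib_left)
  then show ?case using Suc.IH Suc.prems noise_variance[of k] unfolding P_def by simp
qed simp

section \<open>Expected distance and expected gap\<close>

definition xavg :: "nat \<Rightarrow> 'w \<Rightarrow> real^'d" where
  "xavg k \<omega> = (1 / Asc k) *\<^sub>R (\<Sum>i=1..k. a i *\<^sub>R x i \<omega>)"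

definition yavg :: "nat \<Rightarrow> 'w \<Rightarrow> real^'n" where
  "yavg k \<omega> = (1 / Asc k) *\<^sub>R
     (\<Sum>i=1..k. a i *\<^sub>R y i \<omega> + ((real m - 1) * a i) *\<^sub>R (y i \<omega> - y (i - 1) \<omega>))"

lemma xavg_in_X:
  assumes "\<omega> \<in> space M" and k: "k \<in> {1..K}"
  shows "xavg k \<omega> \<in> X"
proof -
  interpret clvr_path X c r A b x0 y0 \<gamma> Lhat \<sigma> K m S "\<lambda>k. j k \<omega>" a Asc
    "\<lambda>k. x k \<omega>" "\<lambda>k. y k \<omega>" "\<lambda>k. z k \<omega>" "\<lambda>k. q k \<omega>" by (rule path[OF assms(1)])
  show ?thesis unfolding xavg_def Asc_eq[OF k] by (rule avg_in_X(1)[OF k])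
qed

lemma pathwise_gap:
  assumes "\<omega> \<in> space M" and k: "k \<in> {1..K}" and u: "u \<in> X"
  shows "Asc k * (lagrangian c r A b (xavg k \<omega>) v - lagrangian c r A b u (yavg k \<omega>))
      + ((\<gamma> + \<sigma> * Asc k) / 4 * (norm (x k \<omega> - u))\<^sup>2 + 1 / (2 * \<gamma>) * (norm (y k \<omega> - v))\<^sup>2)
      + 1 / (4 * \<gamma>) * (\<Sum>i=1..k. sq_step i \<omega>)
    \<le> \<gamma> / 2 * (norm (u - x0))\<^sup>2 + 1 / (2 * \<gamma>) * (norm (v - y0))\<^sup>2
      + (\<Sum>i=1..k. (v - y (i - 1) \<omega>) \<bullet> N i \<omega>)"
proof -
  interpret clvr_path X c r A b x0 y0 \<gamma> Lhat \<sigma> K m S "\<lambda>k. j k \<omega>" a Asc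
    "\<lambda>k. x k \<omega>" "\<lambda>k. y k \<omega>" "\<lambda>k. z k \<omega>" "\<lambda>k. q k \<omega>" by (rule path[OF assms(1)])
  have sq_step: "(norm (dy i))\<^sup>2 = sq_step i \<omega>" for i by (simp only: dy_def sq_step_def)
  have N: "noise i = N i \<omega>" for i by (simp only: noise_def N_def G_def g_def)
  show ?thesis
    using gap_bound[OF k u, of v]
    unfolding xavg_def yavg_def Asc_eq[OF k] Y_def sq_step N
      norm_minus_commute[of "x k \<omega>"] norm_minus_commute[of "y k \<omega>"] add.assoc .
qed

lemma integrable_sum_sq_step: "k \<le> K \<Longrightarrow> integrable M (\<lambda>\<omega>. \<Sum>i=1..k. sq_step i \<omega>)"
  by (intro Bochner_Integration.integrable_sum determined_integrable[OF determined_sq_step]) auto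

lemma noise_term:
  assumes "i \<in> {1..K}"
  shows "integrable M (\<lambda>\<omega>. (v - y (i - 1) \<omega>) \<bullet> N i \<omega>)"
    and "expectation (\<lambda>\<omega>. (v - y (i - 1) \<omega>) \<bullet> N i \<omega>) = 0"
proof -
  obtain l where l: "i = Suc l" "l < K" using assms by (cases i) auto
  have d: "determined l (\<lambda>\<omega>. v - y l \<omega>)"
    using l by (intro determined_map[OF determined_y, of _ "\<lambda>w. v - w"]) simp
  have d': "determined i (\<lambda>\<omega>. v - y l \<omega>)" using determined_mono[OF d] l by simp
  show "integrable M (\<lambda>\<omega>. (v - y (i - 1) \<omega>) \<bullet> N i \<omega>)"
    using determined_integrable[OF determined_map2[OF d' determined_N[OF assms], of "(\<bullet>)"]] l assms
    by simp
  show "expectation (\<lambda>\<omega>. (v - y (i - 1) \<omega>) \<bullet> N i \<omega>) = 0"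
    using noise_orthogonal[OF d l(2)] l by simp
qed

lemma expected_noise:
  assumes "k \<le> K"
  shows "integrable M (\<lambda>\<omega>. \<Sum>i=1..k. (v - y (i - 1) \<omega>) \<bullet> N i \<omega>)"
    and "expectation (\<lambda>\<omega>. \<Sum>i=1..k. (v - y (i - 1) \<omega>) \<bullet> N i \<omega>) = 0"
proof -
  have i: "i \<in> {1..K}" if "i \<in> {1..k}" for i using assms that by simp
  show "integrable M (\<lambda>\<omega>. \<Sum>i=1..k. (v - y (i - 1) \<omega>) \<bullet> N i \<omega>)"
    by (intro Bochner_Integration.integrable_sum noise_term(1) i)
  show "expectation (\<lambda>\<omega>. \<Sum>i=1..k. (v - y (i - 1) \<omega>) \<bullet> N i \<omega>) = 0"
    by (subst Bochner_Integration.integral_sum[OF noise_term(1)[OF i]], assumption)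
      (intro sum.neutral ballI noise_term(2) i)
qed

text \<open>At a Nash point the gap is nonnegative, and the noise has mean zero against the fixed point \<open>ys\<close>.  The
squared dual steps are kept: the next lemma pays for the variance of the noise with them.\<close>

lemma expected_distance:
  assumes nash: "nash_point X c r A b xs ys" and k: "k \<in> {1..K}"
  shows "expectation (\<lambda>\<omega>. (\<gamma> + \<sigma> * Asc k) / 4 * (norm (x k \<omega> - xs))\<^sup>2
        + 1 / (2 * \<gamma>) * (norm (y k \<omega> - ys))\<^sup>2)
      + 1 / (4 * \<gamma>) * (\<Sum>i=1..k. expectation (sq_step i))
    \<le> \<gamma> / 2 * (norm (xs - x0))\<^sup>2 + 1 / (2 * \<gamma>) * (norm (ys - y0))\<^sup>2"
    (is "expectation ?Z + _ \<le> ?C")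
proof -
  have kK: "k \<le> K" using k by simp
  have dx: "determined k (x k)"
  proof -
    have "k - 1 < K" "Suc (k - 1) = k" using k by auto
    then show ?thesis using determined_x[of "k - 1"] by (auto intro: determined_mono)
  qed
  have Z: "integrable M ?Z"
    by (rule determined_integrable[OF determined_map2[OF dx determined_y[OF kK], of
      "\<lambda>u v. (\<gamma> + \<sigma> * Asc k) / 4 * (norm (u - xs))\<^sup>2 + 1 / (2 * \<gamma>) * (norm (v - ys))\<^sup>2"] kK])
  have SV: "integrable M (\<lambda>\<omega>. 1 / (4 * \<gamma>) * (\<Sum>i=1..k. sq_step i \<omega>))"
    using integrable_sum_sq_step[OF kK] by (rule integrable_mult_right)
  have xs: "xs \<in> X" using nash by (simp add: nash_point_def)
  have "expectation (\<lambda>\<omega>. ?Z \<omega> + 1 / (4 * \<gamma>) * (\<Sum>i=1..k. sq_step i \<omega>))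
      \<le> expectation (\<lambda>\<omega>. ?C + (\<Sum>i=1..k. (ys - y (i - 1) \<omega>) \<bullet> N i \<omega>))"
  proof (rule integral_mono)
    show "integrable M (\<lambda>\<omega>. ?Z \<omega> + 1 / (4 * \<gamma>) * (\<Sum>i=1..k. sq_step i \<omega>))"
      by (rule Bochner_Integration.integrable_add[OF Z SV])
    show "integrable M (\<lambda>\<omega>. ?C + (\<Sum>i=1..k. (ys - y (i - 1) \<omega>) \<bullet> N i \<omega>))"
      by (rule Bochner_Integration.integrable_add[OF integrable_const expected_noise(1)[OF kK]])
    fix \<omega> assume w: "\<omega> \<in> space M"
    have "lagrangian c r A b xs (yavg k \<omega>) \<le> lagrangian c r A b (xavg k \<omega>) ys"
      using nash xavg_in_X[OF w k] unfolding nash_point_def by (meson order_trans)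
    then have "0 \<le> Asc k * (lagrangian c r A b (xavg k \<omega>) ys - lagrangian c r A b xs (yavg k \<omega>))"
      using Asc_pos[OF k] by simp
    then show "?Z \<omega> + 1 / (4 * \<gamma>) * (\<Sum>i=1..k. sq_step i \<omega>)
        \<le> ?C + (\<Sum>i=1..k. (ys - y (i - 1) \<omega>) \<bullet> N i \<omega>)"
      using pathwise_gap[OF w k xs, of ys] by linarith
  qed
  also have "\<dots> = ?C"
    by (subst Bochner_Integration.integral_add[OF integrable_const expected_noise(1)[OF kK]])
      (simp only: expected_noise(2)[OF kK], simp add: prob_space)
  also have "expectation (\<lambda>\<omega>. ?Z \<omega> + 1 / (4 * \<gamma>) * (\<Sum>i=1..k. sq_step i \<omega>))
      = expectation ?Z + 1 / (4 * \<gamma>) * (\<Sum>i=1..k. expectation (sq_step i))"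
  proof -
    have "expectation (\<lambda>\<omega>. \<Sum>i=1..k. sq_step i \<omega>) = (\<Sum>i=1..k. expectation (sq_step i))"
      using kK by (intro Bochner_Integration.integral_sum determined_integrable[OF determined_sq_step]) auto
    then show ?thesis by (subst Bochner_Integration.integral_add[OF Z SV]) simp
  qed
  finally show ?thesis .
qed

text \<open>The maximizer \<open>vh\<close> depends on all draws, so the noise no longer averages out against it.  Only
\<open>(vh - y0) \<bullet> P\<close> with the total noise \<open>P\<close> is affected, and Young's inequality turns it into a second copy of
\<open>1 / (2 * \<gamma>) * (norm (vh - y0))\<^sup>2\<close> and a variance.  The variance term is in expectation at most twice the squared dual
steps available in \<open>pathwise_gap\<close>; the excess is bounded by \<open>expected_distance\<close>.\<close>

lemma expected_gap:
  assumes nash: "nash_point X c r A b xs ys" and k: "k \<in> {1..K}"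
    and uh: "\<And>\<omega>. \<omega> \<in> space M \<Longrightarrow> uh \<omega> \<in> X"
    and int: "integrable M (\<lambda>\<omega>. \<gamma> / 2 * (norm (uh \<omega> - x0))\<^sup>2 + 1 / \<gamma> * (norm (vh \<omega> - y0))\<^sup>2)"
      (is "integrable M ?B")
  shows "expectation (\<lambda>\<omega>. lagrangian c r A b (xavg k \<omega>) (vh \<omega>) - lagrangian c r A b (uh \<omega>) (yavg k \<omega>))
    \<le> 1 / Asc k * (expectation ?B
        + \<gamma> / 2 * (norm (xs - x0))\<^sup>2 + 1 / (2 * \<gamma>) * (norm (ys - y0))\<^sup>2)"
    (is "expectation ?gap \<le> 1 / Asc k * (_ + ?C1 + ?C2)")
proof (cases "integrable M ?gap")
  case False
  \<comment> \<open>The expectation of a non-integrable gap is \<open>0\<close> by convention, below the nonnegative right-hand side.\<close>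
  have "0 \<le> expectation ?B" using init by (intro integral_nonneg_AE) simp
  then show ?thesis
    using Asc_pos[OF k] init False by (simp add: not_integrable_integral_eq)
next
  case True
  have kK: "k \<le> K" using k by simp
  define P where "P \<omega> = (\<Sum>i=1..k. N i \<omega>)" for \<omega>
  define E where "E \<omega> = (\<Sum>i=1..k. (y0 - y (i - 1) \<omega>) \<bullet> N i \<omega>)" for \<omega>
  define SV where "SV \<omega> = (\<Sum>i=1..k. sq_step i \<omega>)" for \<omega>
  have "determined k P"
    unfolding P_def using kK by (intro determined_sum determined_mono[OF determined_N]) auto
  then have iP: "integrable M (\<lambda>\<omega>. (norm (P \<omega>))\<^sup>2)"
    using determined_integrable[OF determined_map[of k P "\<lambda>u. (norm u)\<^sup>2"] kK] by simp
  have iE: "integrable M E" and E0: "expectation E = 0"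
    unfolding E_def using expected_noise[OF kK] by auto
  have iPE: "integrable M (\<lambda>\<omega>. \<gamma> / 2 * (norm (P \<omega>))\<^sup>2 + E \<omega>)"
    by (rule Bochner_Integration.integrable_add[OF integrable_mult_right[OF iP] iE])
  have iV: "integrable M SV" unfolding SV_def by (rule integrable_sum_sq_step[OF kK])
  have EV: "expectation SV = (\<Sum>i=1..k. expectation (sq_step i))"
    unfolding SV_def using kK
    by (intro Bochner_Integration.integral_sum determined_integrable[OF determined_sq_step]) auto
  have bound: "Asc k * ?gap \<omega> + 1 / (4 * \<gamma>) * SV \<omega> \<le> ?B \<omega> + (\<gamma> / 2 * (norm (P \<omega>))\<^sup>2 + E \<omega>)"
    if w: "\<omega> \<in> space M" for \<omega>
  proof -
    define h where "h = vh \<omega> - y0"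
    have "(\<Sum>i=1..k. (vh \<omega> - y (i - 1) \<omega>) \<bullet> N i \<omega>) = h \<bullet> P \<omega> + E \<omega>"
      unfolding P_def E_def h_def inner_sum_right sum.distrib[symmetric]
      by (simp add: inner_diff_left)
    moreover have "h \<bullet> P \<omega> \<le> 1 / (2 * \<gamma>) * (norm h)\<^sup>2 + \<gamma> / 2 * (norm (P \<omega>))\<^sup>2"
    proof -
      have "0 \<le> (norm (h - \<gamma> *\<^sub>R P \<omega>))\<^sup>2" by simp
      also have "\<dots> = 2 * \<gamma> * (1 / (2 * \<gamma>) * (norm h)\<^sup>2 + \<gamma> / 2 * (norm (P \<omega>))\<^sup>2 - h \<bullet> P \<omega>)"
        using init unfolding power2_norm_eq_inner
        by (simp add: inner_diff_left inner_diff_right inner_commute[of "P \<omega>" h] algebra_simps)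
      finally show ?thesis using init by (simp add: zero_le_mult_iff)
    qed
    moreover have "0 \<le> (\<gamma> + \<sigma> * Asc k) / 4 * (norm (x k \<omega> - uh \<omega>))\<^sup>2 + 1 / (2 * \<gamma>) * (norm (y k \<omega> - vh \<omega>))\<^sup>2"
      using Asc_pos[OF k] init sigma by simp
    moreover have "1 / \<gamma> * (norm h)\<^sup>2 = 1 / (2 * \<gamma>) * (norm h)\<^sup>2 + 1 / (2 * \<gamma>) * (norm h)\<^sup>2"
      by simp
    ultimately show ?thesis
      using pathwise_gap[OF w k uh[OF w], of "vh \<omega>"] unfolding SV_def h_def by linarith
  qed
  have "Asc k * expectation ?gap + 1 / (4 * \<gamma>) * expectation SV
      = expectation (\<lambda>\<omega>. Asc k * ?gap \<omega> + 1 / (4 * \<gamma>) * SV \<omega>)"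
    by (subst Bochner_Integration.integral_add[OF integrable_mult_right[OF True] integrable_mult_right[OF iV]])
      simp
  also have "\<dots> \<le> expectation (\<lambda>\<omega>. ?B \<omega> + (\<gamma> / 2 * (norm (P \<omega>))\<^sup>2 + E \<omega>))"
    using bound by (rule integral_mono[OF
      Bochner_Integration.integrable_add[OF integrable_mult_right[OF True] integrable_mult_right[OF iV]]
      Bochner_Integration.integrable_add[OF int iPE]])
  also have "\<dots> = expectation ?B + expectation (\<lambda>\<omega>. \<gamma> / 2 * (norm (P \<omega>))\<^sup>2 + E \<omega>)"
    by (rule Bochner_Integration.integral_add[OF int iPE])
  also have "expectation (\<lambda>\<omega>. \<gamma> / 2 * (norm (P \<omega>))\<^sup>2 + E \<omega>) = \<gamma> / 2 * expectation (\<lambda>\<omega>. (norm (P \<omega>))\<^sup>2)"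
    by (subst Bochner_Integration.integral_add[OF integrable_mult_right[OF iP] iE]) (simp add: E0)
  also have "\<dots> \<le> 1 / (2 * \<gamma>) * expectation SV"
  proof -
    have "\<gamma> / 2 * expectation (\<lambda>\<omega>. (norm (P \<omega>))\<^sup>2)
        = 1 / (2 * \<gamma>) * (\<gamma>\<^sup>2 * expectation (\<lambda>\<omega>. (norm (P \<omega>))\<^sup>2))"
      using init by (simp add: power2_eq_square)
    also have "\<dots> \<le> 1 / (2 * \<gamma>) * expectation SV"
      unfolding EV P_def using accumulated_noise_variance[OF kK] init
      by (intro mult_left_mono) auto
    finally show ?thesis .
  qed
  finally have "Asc k * expectation ?gap + 1 / (4 * \<gamma>) * expectation SV
      \<le> expectation ?B + 1 / (2 * \<gamma>) * expectation SV" by simp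
  moreover have "1 / (2 * \<gamma>) * expectation SV
      = 1 / (4 * \<gamma>) * expectation SV + 1 / (4 * \<gamma>) * expectation SV" by simp
  moreover have "1 / (4 * \<gamma>) * expectation SV \<le> ?C1 + ?C2"
  proof -
    have "0 \<le> expectation (\<lambda>\<omega>. (\<gamma> + \<sigma> * Asc k) / 4 * (norm (x k \<omega> - xs))\<^sup>2
        + 1 / (2 * \<gamma>) * (norm (y k \<omega> - ys))\<^sup>2)"
      using Asc_pos[OF k] init sigma by (intro integral_nonneg_AE) simp
    then show ?thesis using expected_distance[OF nash k] unfolding EV by linarith
  qed
  ultimately have "Asc k * expectation ?gap \<le> expectation ?B + ?C1 + ?C2" by linarith
  then show ?thesis using Asc_pos[OF k] by (simp add: field_simps)
qed

end

section \<open>Convergence of CLVR\<close>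

theorem theorem1:
  fixes X :: "(real^'d) set" and c :: "real^'d" and r :: "real^'d \<Rightarrow> real"
    and A :: "real^'d^'n" and b :: "real^'n"
    and x0 :: "real^'d" and y0 :: "real^'n"
    and \<gamma> Lhat \<sigma> :: real and K m :: nat and S :: "nat \<Rightarrow> 'n set"
    and M :: "'w measure" and j :: "nat \<Rightarrow> 'w \<Rightarrow> nat"
    and a Asc :: "nat \<Rightarrow> real"
    and x z q xt :: "nat \<Rightarrow> 'w \<Rightarrow> real^'d" and y yt :: "nat \<Rightarrow> 'w \<Rightarrow> real^'n"
    and W :: "nat \<Rightarrow> 'w \<Rightarrow> ((real^'d) \<times> (real^'n)) set" and Wbig :: "((real^'d) \<times> (real^'n)) set"
    and uh :: "nat \<Rightarrow> 'w \<Rightarrow> real^'d" and vh :: "nat \<Rightarrow> 'w \<Rightarrow> real^'n"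
    and xs :: "real^'d" and ys :: "real^'n" and K0 :: int
  assumes X: "closed X" "convex X"
    and r: "convex_on UNIV r"
    and sigma: "\<sigma> \<ge> 0" "strongly_convex_on \<sigma> X r"
    and blocks: "inj_on S {1..m}" "partition_on UNIV (S ` {1..m})"
    and Lhat: "Lhat = Max ((\<lambda>i. spectral_norm (row_block (S i) A)) ` {1..m})" "Lhat > 0"
    and init: "x0 \<in> X" "\<gamma> > 0"
    and prob: "prob_space M"
    and j_indep: "prob_space.indep_vars M (\<lambda>_. count_space {1..m}) j {1..K}"
    and j_unif: "\<And>k. k \<in> {1..K} \<Longrightarrow>
      distr M (count_space {1..m}) (j k) = uniform_count_measure {1..m}"
    and clvr: "\<And>\<omega>. \<omega> \<in> space M \<Longrightarrow>
      clvr_run X c r A b x0 y0 \<gamma> Lhat \<sigma> K m S (\<lambda>k. j k \<omega>) a Asc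
        (\<lambda>k. x k \<omega>) (\<lambda>k. y k \<omega>) (\<lambda>k. z k \<omega>) (\<lambda>k. q k \<omega>)"
    and xt: "\<And>k \<omega>. k \<in> {1..K} \<Longrightarrow> \<omega> \<in> space M \<Longrightarrow>
      xt k \<omega> = (1 / Asc k) *\<^sub>R (\<Sum>i=1..k. a i *\<^sub>R x i \<omega>)"
    and yt: "\<And>k \<omega>. k \<in> {1..K} \<Longrightarrow> \<omega> \<in> space M \<Longrightarrow>
      yt k \<omega> = (1 / Asc k) *\<^sub>R
        (\<Sum>i=1..k. a i *\<^sub>R y i \<omega> + ((real m - 1) * a i) *\<^sub>R (y i \<omega> - y (i - 1) \<omega>))"
    and Wbig: "compact Wbig" "convex Wbig" "Wbig \<subseteq> X \<times> UNIV"
    and W: "\<And>k \<omega>. k \<in> {1..K} \<Longrightarrow> \<omega> \<in> space M \<Longrightarrow>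
      compact (W k \<omega>) \<and> convex (W k \<omega>) \<and> (xt k \<omega>, yt k \<omega>) \<in> W k \<omega> \<and> W k \<omega> \<subseteq> Wbig"
    and argsup: "\<And>k \<omega>. k \<in> {1..K} \<Longrightarrow> \<omega> \<in> space M \<Longrightarrow>
      is_arg_max (\<lambda>(u, v). lagrangian c r A b (xt k \<omega>) v - lagrangian c r A b u (yt k \<omega>))
        (\<lambda>w. w \<in> W k \<omega>) (uh k \<omega>, vh k \<omega>)"
    and argsup_meas: "\<And>k. k \<in> {1..K} \<Longrightarrow> uh k \<in> borel_measurable M"
      "\<And>k. k \<in> {1..K} \<Longrightarrow> vh k \<in> borel_measurable M"
    and nash: "nash_point X c r A b xs ys"
    and K0: "K0 = \<lceil>\<sigma> / (18 * Lhat * real m * \<gamma>)\<rceil>"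
  shows "\<forall>k\<in>{1..K}.
      (LINT \<omega>|M. (SUP (u, v)\<in>W k \<omega>.
          lagrangian c r A b (xt k \<omega>) v - lagrangian c r A b u (yt k \<omega>)))
        \<le> 1 / Asc k *
          ((LINT \<omega>|M. \<gamma> / 2 * (norm (uh k \<omega> - x0))\<^sup>2 + 1 / \<gamma> * (norm (vh k \<omega> - y0))\<^sup>2)
            + \<gamma> / 2 * (norm (xs - x0))\<^sup>2 + 1 / (2 * \<gamma>) * (norm (ys - y0))\<^sup>2)
      \<and> (LINT \<omega>|M. (\<gamma> + \<sigma> * Asc k) / 4 * (norm (x k \<omega> - xs))\<^sup>2
            + 1 / (2 * \<gamma>) * (norm (y k \<omega> - ys))\<^sup>2)
        \<le> \<gamma> / 2 * (norm (xs - x0))\<^sup>2 + 1 / (2 * \<gamma>) * (norm (ys - y0))\<^sup>2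
      \<and> Asc k \<ge> real k / (2 * Lhat * real m)
      \<and> (K0 \<le> int k \<longrightarrow>
          Asc k \<ge> max (real k / (2 * Lhat * real m))
            (\<sigma> / ((6 * Lhat * real m)\<^sup>2 * \<gamma>) *
              (real k - of_int K0 + max (3 * sqrt (2 * Lhat * real m * \<gamma> / \<sigma>)) 1)\<^sup>2))"
proof (intro ballI)
  fix k assume k: "k \<in> {1..K}"
  interpret prob_space M by (rule prob)
  interpret P: clvr_process X c r A b x0 y0 \<gamma> Lhat \<sigma> K m S M j a Asc x z q y
    using assms by unfold_locales auto
  define B where "B = 2 * Lhat * real m"
  have B: "B > 0" using Lhat P.m_pos by (simp add: B_def)
  have xt': "xt k \<omega> = P.xavg k \<omega>" if "\<omega> \<in> space M" for \<omega> using xt[OF k that] by (simp only: P.xavg_def)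
  have yt': "yt k \<omega> = P.yavg k \<omega>" if "\<omega> \<in> space M" for \<omega> using yt[OF k that] by (simp only: P.yavg_def)
  define B0 where "B0 \<omega> = \<gamma> / 2 * (norm (uh k \<omega> - x0))\<^sup>2 + 1 / \<gamma> * (norm (vh k \<omega> - y0))\<^sup>2" for \<omega>
  have inW: "(uh k \<omega>, vh k \<omega>) \<in> Wbig" if w: "\<omega> \<in> space M" for \<omega>
    using argsup[OF k w] W[OF k w] by (auto simp: is_arg_max_def)
  \<comment> \<open>The maximizers stay in the fixed compact set \<open>Wbig\<close>, hence are bounded uniformly in \<open>\<omega>\<close>.\<close>
  have "integrable M B0"
  proof -
    define f where "f w = \<gamma> / 2 * (norm (fst w - x0))\<^sup>2 + 1 / \<gamma> * (norm (snd w - y0))\<^sup>2"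
      for w :: "(real^'d) \<times> (real^'n)"
    have "compact (f ` Wbig)"
      unfolding f_def by (intro compact_continuous_image continuous_intros Wbig(1))
    then obtain C where C: "\<And>w. w \<in> Wbig \<Longrightarrow> norm (f w) \<le> C"
      using compact_imp_bounded bounded_iff by (metis imageI)
    have "norm (B0 \<omega>) \<le> C" if "\<omega> \<in> space M" for \<omega>
      using C[OF inW[OF that]] by (simp add: f_def B0_def)
    moreover have "B0 \<in> borel_measurable M"
      unfolding B0_def using argsup_meas[OF k] by measurable
    ultimately show ?thesis by (intro integrable_const_bound[of _ C]) auto
  qed
  moreover have "uh k \<omega> \<in> X" if "\<omega> \<in> space M" for \<omega>
    using inW[OF that] Wbig(3) by auto
  ultimately have gap: "expectation (\<lambda>\<omega>. lagrangian c r A b (P.xavg k \<omega>) (vh k \<omega>)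
        - lagrangian c r A b (uh k \<omega>) (P.yavg k \<omega>))
      \<le> 1 / Asc k * (expectation B0
        + \<gamma> / 2 * (norm (xs - x0))\<^sup>2 + 1 / (2 * \<gamma>) * (norm (ys - y0))\<^sup>2)"
    unfolding B0_def[abs_def] using P.expected_gap[OF nash k, of "uh k" "vh k"] by simp
  have sup: "(SUP (u, v)\<in>W k \<omega>. lagrangian c r A b (xt k \<omega>) v - lagrangian c r A b u (yt k \<omega>))
      = lagrangian c r A b (P.xavg k \<omega>) (vh k \<omega>) - lagrangian c r A b (uh k \<omega>) (P.yavg k \<omega>)"
    if w: "\<omega> \<in> space M" for \<omega>
  proof -
    define f where "f = (\<lambda>(u, v). lagrangian c r A b (xt k \<omega>) v - lagrangian c r A b u (yt k \<omega>))"
    have am: "is_arg_max f (\<lambda>w. w \<in> W k \<omega>) (uh k \<omega>, vh k \<omega>)"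
      unfolding f_def by (rule argsup[OF k w])
    have "Sup (f ` W k \<omega>) = f (uh k \<omega>, vh k \<omega>)"
      by (rule cSup_eq_maximum) (use am in \<open>auto simp: is_arg_max_def not_less\<close>)
    then show ?thesis by (simp add: f_def xt'[OF w] yt'[OF w])
  qed
  have "(LINT \<omega>|M. (SUP (u, v)\<in>W k \<omega>.
          lagrangian c r A b (xt k \<omega>) v - lagrangian c r A b u (yt k \<omega>)))
      = expectation (\<lambda>\<omega>. lagrangian c r A b (P.xavg k \<omega>) (vh k \<omega>)
        - lagrangian c r A b (uh k \<omega>) (P.yavg k \<omega>))"
    by (rule Bochner_Integration.integral_cong[OF refl sup])
  then have first: "(LINT \<omega>|M. (SUP (u, v)\<in>W k \<omega>.
          lagrangian c r A b (xt k \<omega>) v - lagrangian c r A b u (yt k \<omega>)))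
      \<le> 1 / Asc k *
          ((LINT \<omega>|M. \<gamma> / 2 * (norm (uh k \<omega> - x0))\<^sup>2 + 1 / \<gamma> * (norm (vh k \<omega> - y0))\<^sup>2)
            + \<gamma> / 2 * (norm (xs - x0))\<^sup>2 + 1 / (2 * \<gamma>) * (norm (ys - y0))\<^sup>2)"
    using gap unfolding B0_def[abs_def] by simp
  have "0 \<le> (\<Sum>i=1..k. expectation (P.sq_step i))"
    by (intro sum_nonneg integral_nonneg_AE) (simp add: P.sq_step_def)
  then have "0 \<le> 1 / (4 * \<gamma>) * (\<Sum>i=1..k. expectation (P.sq_step i))" using init by simp
  then have second: "(LINT \<omega>|M. (\<gamma> + \<sigma> * Asc k) / 4 * (norm (x k \<omega> - xs))\<^sup>2
            + 1 / (2 * \<gamma>) * (norm (y k \<omega> - ys))\<^sup>2)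
        \<le> \<gamma> / 2 * (norm (xs - x0))\<^sup>2 + 1 / (2 * \<gamma>) * (norm (ys - y0))\<^sup>2"
    using P.expected_distance[OF nash k] by linarith
  have A1: "Asc 1 = 1 / B" using P.Asc_1 by (simp add: B_def)
  have As: "Asc (l + 1) = Asc l + sqrt (1 + \<sigma> / \<gamma> * Asc l) / B" if "1 \<le> l" "l < K" for l
    using P.Asc_Suc[of l] that by (simp add: B_def)
  have third: "real k / (2 * Lhat * real m) \<le> Asc k"
    using scalar_growth[OF B _ A1 As, of k] sigma init k by (simp add: B_def)
  \<comment> \<open>For \<open>\<sigma> = 0\<close> the quadratic bound degenerates to \<open>0\<close>; otherwise \<open>K0 \<ge> 0\<close> is a natural number.\<close>
  have fourth: "\<sigma> / ((6 * Lhat * real m)\<^sup>2 * \<gamma>) *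
        (real k - of_int K0 + max (3 * sqrt (2 * Lhat * real m * \<gamma> / \<sigma>)) 1)\<^sup>2 \<le> Asc k"
    if K0k: "K0 \<le> int k"
  proof (cases "\<sigma> = 0")
    case True
    then show ?thesis using P.Asc_pos[OF k] by simp
  next
    case False
    then have s: "\<sigma> / \<gamma> > 0" using sigma init by simp
    have e: "\<sigma> / \<gamma> / (9 * B) = \<sigma> / (18 * Lhat * real m * \<gamma>)" by (simp add: B_def field_simps)
    have "0 < \<sigma> / \<gamma> / (9 * B)" by (rule divide_pos_pos[OF s]) (use B in simp)
    then have "0 \<le> K0" unfolding K0 e[symmetric] by linarith
    then obtain k0 where k0: "K0 = int k0" using nonneg_int_cases by blast
    have k0': "int k0 = \<lceil>\<sigma> / \<gamma> / (9 * B)\<rceil>" using K0 unfolding e k0 .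
    have "\<sigma> / \<gamma> / (9 * B\<^sup>2) * (real k - real k0 + max (3 * sqrt (B / (\<sigma> / \<gamma>))) 1)\<^sup>2 \<le> Asc k"
      by (rule scalar_quadratic_growth[OF B s A1 As k0']) (use k K0k k0 in auto)
    moreover have e1: "\<sigma> / \<gamma> / (9 * B\<^sup>2) = \<sigma> / ((6 * Lhat * real m)\<^sup>2 * \<gamma>)"
      by (simp add: B_def power_mult_distrib field_simps)
    moreover have e2: "B / (\<sigma> / \<gamma>) = 2 * Lhat * real m * \<gamma> / \<sigma>" by (simp add: B_def)
    ultimately show ?thesis unfolding e1 e2 k0 of_int_of_nat_eq by blast
  qed
  show "(LINT \<omega>|M. (SUP (u, v)\<in>W k \<omega>.
          lagrangian c r A b (xt k \<omega>) v - lagrangian c r A b u (yt k \<omega>)))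
        \<le> 1 / Asc k *
          ((LINT \<omega>|M. \<gamma> / 2 * (norm (uh k \<omega> - x0))\<^sup>2 + 1 / \<gamma> * (norm (vh k \<omega> - y0))\<^sup>2)
            + \<gamma> / 2 * (norm (xs - x0))\<^sup>2 + 1 / (2 * \<gamma>) * (norm (ys - y0))\<^sup>2)
      \<and> (LINT \<omega>|M. (\<gamma> + \<sigma> * Asc k) / 4 * (norm (x k \<omega> - xs))\<^sup>2
            + 1 / (2 * \<gamma>) * (norm (y k \<omega> - ys))\<^sup>2)
        \<le> \<gamma> / 2 * (norm (xs - x0))\<^sup>2 + 1 / (2 * \<gamma>) * (norm (ys - y0))\<^sup>2
      \<and> Asc k \<ge> real k / (2 * Lhat * real m)
      \<and> (K0 \<le> int k \<longrightarrow>
          Asc k \<ge> max (real k / (2 * Lhat * real m))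
            (\<sigma> / ((6 * Lhat * real m)\<^sup>2 * \<gamma>) *
              (real k - of_int K0 + max (3 * sqrt (2 * Lhat * real m * \<gamma> / \<sigma>)) 1)\<^sup>2))"
    using first second third fourth by simp
qed

end
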